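(* Let $G$ be a finite group and $V$ a finite dimensional (not necessarily faithful) $\mathbb{C}G$-module. Let $g\in G$ and let $B=\{v_1,\ldots,v_n\}$ be a basis of $V$ consisting of eigenvectors of $g$. Then $$\Upsilon_{g,B}=\Psi^*_{g,B}$$ as maps on cochains, i.e. as maps $S(V)\bar g\otimes\bigwedge^pV^*\to\operatorname{Hom}_{\mathbb{C}}(S(V)^{\otimes p},S(V)\bar g)$ for all $p$. Thus $\Upsilon_{g,B}$ is a cochain map (from the Koszul cochain complex to the bar cochain complex with coefficients in $S(V)\bar g$).
   Context: Write ${}^gv$ for the action of $g\in G$ on $v\in V$; it extends to $S(V)$ by algebra automorphisms. The skew group algebra $S(V)\#G$ is $S(V)\otimes\mathbb{C}G$ with product $(a\otimes g)(b\otimes h)=a({}^gb)\otimes gh$; write $a\bar g=a\otimes g$. Then $S(V)\bar g$ is an $S(V)$-bimodule. $S(V)^e=S(V)\otimes S(V)^{op}$, and bimodules are left $S(V)^e$-modules via $(a\otimes b)m=amb$. Tensor and exterior products are over $\mathbb{C}$. Bar resolution of $S(V)$: $S(V)^{\otimes(p+2)}$ in degree $p\ge0$, $\delta_p(a_0\otimes\cdots\otimes a_{p+1})=\sum_{j=0}^p(-1)^ja_0\otimes\cdots\otimes a_ja_{j+1}\otimes\cdots\otimes a_{p+1}$. Koszul resolution of $S(V)$: $S(V)^e\otimes\bigwedge^p(V)$ in degree $p\ge0$, with $S(V)^e$-linear $d_p(1\otimes1\otimes v_{j_1}\wedge\cdots\wedge v_{j_p})=\sum_{i=1}^p(-1)^{i+1}(v_{j_i}\otimes1-1\otimes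 v_{j_i})\otimes(v_{j_1}\wedge\cdots\wedge\hat v_{j_i}\wedge\cdots\wedge v_{j_p})$. Applying $\operatorname{Hom}_{S(V)^e}(-,S(V)\bar g)$ gives the bar cochain complex, identified with $\operatorname{Hom}_{\mathbb{C}}(S(V)^{\otimes p},S(V)\bar g)$ (by $F\mapsto F(1\otimes-\otimes1)$), and the Koszul cochain complex, identified with $\operatorname{Hom}_{\mathbb{C}}(\bigwedge^pV,S(V)\bar g)=S(V)\bar g\otimes\bigwedge^pV^*=:C^p_g$; here, for the dual basis $v_1^*,\ldots,v_n^*$ and increasing indices, $f\bar g\otimes v_{j_1}^*\wedge\cdots\wedge v_{j_p}^*$ sends $v_{j_1}\wedge\cdots\wedge v_{j_p}$ to $f\bar g$ and every other $v_{i_1}\wedge\cdots\wedge v_{i_p}$ ($i_1<\cdots<i_p$) to $0$. The map $\Psi_B$: write $\underline v^{\underline\ell}=v_1^{\ell_1}\cdots v_n^{\ell_n}$. $(\Psi_B)_0$ is the identity, and for $p\ge1$, $(\Psi_B)_p:S(V)^{\otimes(p+2)}\to S(V)^e\otimes\bigwedge^p(V)$ is $S(V)^e$-linear with $$(\Psi_B)_p(1\otimes\underline v^{\underline\ell^1}\otimes\cdots\otimes\underline v^{\underline\ell^p}\otimes1)=\sum_{1\le i_1<\cdots<i_p\le n}\ \sum_{0\le a_{i_j}<\ell^j_{i_j}}\underline v^{\underline Q}\otimes\underline v^{\underline{\hat Q}}\otimes v_{i_1}\wedge\cdots\wedge v_{i_p},$$ the second sum being over all integers $a_{i_1},\ldots,a_{i_p}$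 with $0\le a_{i_j}<\ell^j_{i_j}$ for all $j$; here $\underline Q_i=a_i+\ell_i^1+\cdots+\ell_i^{j-1}$ if $i=i_j$ and $\underline Q_i=\ell_i^1+\cdots+\ell_i^j$ if $i_j<i<i_{j+1}$ (with $i_0=0$, $i_{p+1}=n+1$), and $\underline{\hat Q}$ is determined by $\underline v^{\underline Q}\,\underline v^{\underline{\hat Q}}\,v_{i_1}\cdots v_{i_p}=\underline v^{\underline\ell^1}\cdots\underline v^{\underline\ell^p}$. $\Psi_{g,B}^*$ denotes the map on cochains obtained from $\Psi_B$ by applying $\operatorname{Hom}_{S(V)^e}(-,S(V)\bar g)$ (precomposition with $\Psi_B$). The map $\Upsilon_{g,B}$: let ${}^gv_i=\epsilon_iv_i$, and let $s_i\in GL(V)$ be defined by ${}^{s_i}v_j=v_j$ for $j\ne i$ and ${}^{s_i}v_i=\epsilon_iv_i$ (so $g$ acts as $s_1\cdots s_n$). Let $\partial_i:S(V)\to S(V)$ be $\partial_i(f)=\dfrac{f-{}^{s_i}f}{v_i-{}^{s_i}v_i}$ if $\epsilon_i\ne1$, and $\partial_i=\partial/\partial v_i$ if $\epsilon_i=1$. For $\alpha=f_g\bar g\otimes v_{j_1}^*\wedge\cdots\wedge v_{j_p}^*$ with $f_g\in S(V)$ and $1\le j_1<\cdots<j_p\le n$, set $$\Upsilon_{g,B}(\alpha)(f_1\otimes\cdots\otimes f_p)=\Bigl(\prod_{k=1}^p{}^{s_1s_2\cdots s_{j_k-1}}(\partial_{j_k}f_k)\Bigr)f_g\bar g,$$ and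 extend linearly to $C^p_g$. *)

theory Defs
  imports "HOL-Library.Poly_Mapping" "HOL-Algebra.Group" "HOL-Library.FuncSet" "HOL-Library.Product_Plus" Complex_Main
begin

section \<open>The module \<open>V\<close> and its symmetric algebra\<close>

text \<open>
  \<open>V\<close> is a complex vector space given by a scalar multiplication \<open>scale\<close> on a type (in the sense
  of the library locale \<open>vector_space\<close>), and \<open>v 1, ..., v n\<close> is a basis of it; \<open>n = 0\<close> is allowed.
\<close>

definition cg_module ::
  "('g, 'm) monoid_scheme \<Rightarrow> (complex \<Rightarrow> 'v \<Rightarrow> 'v) \<Rightarrow> ('g \<Rightarrow> 'v \<Rightarrow> 'v::ab_group_add) \<Rightarrow> bool" where
  "cg_module G scale \<rho> \<longleftrightarrow>
     vector_space scale \<and>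
     (\<forall>h\<in>carrier G. Vector_Spaces.linear scale scale (\<rho> h)) \<and>
     \<rho> \<one>\<^bsub>G\<^esub> = id \<and>
     (\<forall>h\<in>carrier G. \<forall>k\<in>carrier G. \<rho> (h \<otimes>\<^bsub>G\<^esub> k) = \<rho> h \<circ> \<rho> k)"

definition is_basis :: "(complex \<Rightarrow> 'v \<Rightarrow> 'v) \<Rightarrow> nat \<Rightarrow> (nat \<Rightarrow> 'v::ab_group_add) \<Rightarrow> bool" where
  "is_basis scale n v \<longleftrightarrow>
     inj_on v {1..n} \<and>
     \<not> module.dependent scale (v ` {1..n}) \<and>
     module.span scale (v ` {1..n}) = UNIV"

text \<open>
  \<open>S(V)\<close> is identified with the polynomial ring \<open>\<complex>[v\<^sub>1, ..., v\<^sub>n]\<close>: an exponent vector is a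
  finitely supported map \<open>nat \<Rightarrow> nat\<close>, and the variable with index \<open>i\<close> is the vector \<open>v i\<close>.
  Since the index type is infinite, \<open>S(V)\<close> is the subalgebra \<open>SV n\<close> of polynomials involving only
  the variables with indices \<open>1, ..., n\<close>.
\<close>

type_synonym mon = "nat \<Rightarrow>\<^sub>0 nat"
type_synonym spoly = "mon \<Rightarrow>\<^sub>0 complex"

definition mons :: "nat \<Rightarrow> mon set" where
  "mons n = {m. Poly_Mapping.keys m \<subseteq> {1..n}}"

definition SV :: "nat \<Rightarrow> spoly set" where
  "SV n = {f. Poly_Mapping.keys f \<subseteq> mons n}"

definition cst :: "complex \<Rightarrow> spoly" where
  "cst c = Poly_Mapping.single 0 c"

definition xmon :: "mon \<Rightarrow> spoly" where
  "xmon m = Poly_Mapping.single m 1"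

definition xvar :: "nat \<Rightarrow> spoly" where
  "xvar i = xmon (Poly_Mapping.single i 1)"

definition coord ::
  "(complex \<Rightarrow> 'v \<Rightarrow> 'v) \<Rightarrow> nat \<Rightarrow> (nat \<Rightarrow> 'v::ab_group_add) \<Rightarrow> 'v \<Rightarrow> nat \<Rightarrow> complex" where
  "coord scale n v w i = module.representation scale (v ` {1..n}) w (v i)"

text \<open>The inclusion of \<open>V\<close> into \<open>S(V)\<close>.\<close>

definition emb ::
  "(complex \<Rightarrow> 'v \<Rightarrow> 'v) \<Rightarrow> nat \<Rightarrow> (nat \<Rightarrow> 'v::ab_group_add) \<Rightarrow> 'v \<Rightarrow> spoly" where
  "emb scale n v w = (\<Sum>i\<in>{1..n}. cst (coord scale n v w i) * xvar i)"

text \<open>The algebra endomorphism of \<open>S(V)\<close> extending a linear endomorphism \<open>T\<close> of \<open>V\<close>.\<close>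

definition symext ::
  "(complex \<Rightarrow> 'v \<Rightarrow> 'v) \<Rightarrow> nat \<Rightarrow> (nat \<Rightarrow> 'v::ab_group_add) \<Rightarrow> ('v \<Rightarrow> 'v) \<Rightarrow> spoly \<Rightarrow> spoly" where
  "symext scale n v T f =
     (\<Sum>m\<in>Poly_Mapping.keys f. cst (Poly_Mapping.lookup f m) *
        (\<Prod>i\<in>Poly_Mapping.keys m. emb scale n v (T (v i)) ^ Poly_Mapping.lookup m i))"

definition gact ::
  "(complex \<Rightarrow> 'v \<Rightarrow> 'v) \<Rightarrow> nat \<Rightarrow> (nat \<Rightarrow> 'v::ab_group_add) \<Rightarrow> ('g \<Rightarrow> 'v \<Rightarrow> 'v) \<Rightarrow>
     'g \<Rightarrow> spoly \<Rightarrow> spoly" where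
  "gact scale n v \<rho> h = symext scale n v (\<rho> h)"


section \<open>The skew group algebra and its bimodule structure\<close>

text \<open>
  \<open>S(V) # G\<close> consists of finitely supported maps from \<open>G\<close> to \<open>S(V)\<close>; the element \<open>f \<otimes> h\<close> is
  \<open>Poly_Mapping.single h f\<close>.  The parameter \<open>A\<close> below is the action of \<open>G\<close> on \<open>S(V)\<close>, that is
  \<open>gact scale n v \<rho>\<close>.
\<close>

type_synonym 'g skew = "'g \<Rightarrow>\<^sub>0 spoly"

definition skew_mult ::
  "('g, 'm) monoid_scheme \<Rightarrow> ('g \<Rightarrow> spoly \<Rightarrow> spoly) \<Rightarrow> 'g skew \<Rightarrow> 'g skew \<Rightarrow> 'g skew" where
  "skew_mult G A F H =
     (\<Sum>h\<in>Poly_Mapping.keys F. \<Sum>k\<in>Poly_Mapping.keys H.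
        Poly_Mapping.single (h \<otimes>\<^bsub>G\<^esub> k) (Poly_Mapping.lookup F h * A h (Poly_Mapping.lookup H k)))"

definition incl :: "('g, 'm) monoid_scheme \<Rightarrow> spoly \<Rightarrow> 'g skew" where
  "incl G a = Poly_Mapping.single \<one>\<^bsub>G\<^esub> a"

definition cscale :: "complex \<Rightarrow> 'g skew \<Rightarrow> 'g skew" where
  "cscale c F = Poly_Mapping.map (\<lambda>f. cst c * f) F"

text \<open>The sub-bimodule \<open>S(V) g\<close> of \<open>S(V) # G\<close>.\<close>

definition Sbar :: "nat \<Rightarrow> 'g \<Rightarrow> 'g skew set" where
  "Sbar n g = Poly_Mapping.single g ` SV n"

text \<open>
  The enveloping algebra \<open>S(V) \<otimes> S(V)\<^sup>o\<^sup>p\<close>: since \<open>S(V)\<close> is commutative, this is the monoid algebra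
  of pairs of exponent vectors, the pair \<open>(a, b)\<close> standing for the tensor of the two monomials.
  It acts on bimodules by \<open>(a \<otimes> b) m = a m b\<close>.
\<close>

type_synonym senv = "(mon \<times> mon) \<Rightarrow>\<^sub>0 complex"

definition env_act ::
  "('g, 'm) monoid_scheme \<Rightarrow> ('g \<Rightarrow> spoly \<Rightarrow> spoly) \<Rightarrow> senv \<Rightarrow> 'g skew \<Rightarrow> 'g skew" where
  "env_act G A x m =
     (\<Sum>(a, b)\<in>Poly_Mapping.keys x. cscale (Poly_Mapping.lookup x (a, b))
        (skew_mult G A (skew_mult G A (incl G (xmon a)) m) (incl G (xmon b))))"


section \<open>The bar resolution\<close>

text \<open>
  The \<open>k\<close>-fold tensor power of \<open>S(V)\<close> has as basis the tensors of monomials, so it is the space of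
  finitely supported complex functions on lists of length \<open>k\<close> of exponent vectors.
  \<open>ptens fs\<close> is the pure tensor of the list \<open>fs\<close> of polynomials.
\<close>

type_synonym stens = "mon list \<Rightarrow>\<^sub>0 complex"

fun ptens :: "spoly list \<Rightarrow> stens" where
  "ptens [] = Poly_Mapping.single [] 1"
| "ptens (f # fs) =
     (\<Sum>m\<in>Poly_Mapping.keys f. \<Sum>ms\<in>Poly_Mapping.keys (ptens fs).
        Poly_Mapping.single (m # ms) (Poly_Mapping.lookup f m * Poly_Mapping.lookup (ptens fs) ms))"

text \<open>
  The differential \<open>\<delta>\<^sub>p\<close>, to be used on tensors of length \<open>p + 2\<close>.  A product of monomials is the
  sum of their exponent vectors.
\<close>

definition bar_d :: "nat \<Rightarrow> stens \<Rightarrow> stens" where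
  "bar_d p t =
     (\<Sum>ms\<in>Poly_Mapping.keys t. \<Sum>j\<le>p.
        Poly_Mapping.single (take j ms @ [ms ! j + ms ! (j + 1)] @ drop (j + 2) ms)
          ((-1) ^ j * Poly_Mapping.lookup t ms))"


section \<open>The Koszul resolution\<close>

text \<open>
  The basis \<open>v\<^sub>j\<^sub>1 \<and> ... \<and> v\<^sub>j\<^sub>p\<close> (with increasing indices) of the \<open>p\<close>-th exterior power is indexed by
  the strictly increasing lists of indices; \<open>S(V)\<^sup>e \<otimes> \<And>\<^sup>p V\<close> is the free module over the enveloping
  algebra on these lists.
\<close>

definition inc :: "nat \<Rightarrow> nat \<Rightarrow> nat list set" where
  "inc n p = {J. length J = p \<and> sorted_wrt (<) J \<and> set J \<subseteq> {1..n}}"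

type_synonym kosz = "nat list \<Rightarrow>\<^sub>0 senv"

text \<open>
  List positions start at \<open>0\<close>, so position \<open>i\<close> here is position \<open>i + 1\<close> of the wedge product; the
  sign \<open>(-1)\<^sup>i\<^sup>+\<^sup>1\<close> for positions counted from \<open>1\<close> becomes \<open>(-1)\<^sup>i\<close>.
\<close>

definition kos_d :: "nat \<Rightarrow> kosz \<Rightarrow> kosz" where
  "kos_d p \<kappa> =
     (\<Sum>J\<in>Poly_Mapping.keys \<kappa>. \<Sum>i<p.
        Poly_Mapping.single (take i J @ drop (i + 1) J)
          (Poly_Mapping.lookup \<kappa> J * ((-1) ^ i *
            (Poly_Mapping.single (Poly_Mapping.single (J ! i) 1, 0) 1 -
             Poly_Mapping.single (0, Poly_Mapping.single (J ! i) 1) 1))))"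


section \<open>Cochain complexes\<close>

text \<open>
  A Koszul cochain \<open>\<Sum>\<^sub>J f\<^sub>J g \<otimes> v\<^sub>J\<^sup>*\<close> is the finitely supported map sending the increasing list \<open>J\<close> to
  \<open>f\<^sub>J g\<close>; so \<open>Poly_Mapping.single J (Poly_Mapping.single g f)\<close> is \<open>f g \<otimes> v\<^sub>j\<^sub>1\<^sup>* \<and> ... \<and> v\<^sub>j\<^sub>p\<^sup>*\<close>, and
  evaluating a cochain at the basis vector \<open>v\<^sub>J\<close> of the exterior power is \<open>Poly_Mapping.lookup\<close>.
\<close>

type_synonym 'g kcochain = "nat list \<Rightarrow>\<^sub>0 'g skew"

definition kcochains :: "nat \<Rightarrow> 'g \<Rightarrow> nat \<Rightarrow> 'g kcochain set" where
  "kcochains n g p =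
     {\<alpha>. Poly_Mapping.keys \<alpha> \<subseteq> inc n p \<and> (\<forall>J. Poly_Mapping.lookup \<alpha> J \<in> Sbar n g)}"

text \<open>
  The \<open>S(V)\<^sup>e\<close>-linear map \<open>S(V)\<^sup>e \<otimes> \<And>\<^sup>p V \<rightarrow> S(V) g\<close> corresponding to a Koszul cochain.
\<close>

definition kos_hom ::
  "('g, 'm) monoid_scheme \<Rightarrow> ('g \<Rightarrow> spoly \<Rightarrow> spoly) \<Rightarrow> 'g kcochain \<Rightarrow> kosz \<Rightarrow> 'g skew" where
  "kos_hom G A \<alpha> \<kappa> =
     (\<Sum>J\<in>Poly_Mapping.keys \<kappa>. env_act G A (Poly_Mapping.lookup \<kappa> J) (Poly_Mapping.lookup \<alpha> J))"

definition kos_codiff ::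
  "('g, 'm) monoid_scheme \<Rightarrow> ('g \<Rightarrow> spoly \<Rightarrow> spoly) \<Rightarrow> nat \<Rightarrow> nat \<Rightarrow> 'g kcochain \<Rightarrow> 'g kcochain" where
  "kos_codiff G A n p \<alpha> =
     (\<Sum>J\<in>inc n (p + 1).
        Poly_Mapping.single J (kos_hom G A \<alpha> (kos_d (p + 1) (Poly_Mapping.single J 1))))"

text \<open>
  A linear map from the \<open>p\<close>-th tensor power of \<open>S(V)\<close> to \<open>S(V) g\<close> is given by its values on pure
  tensors, i.e. as a multilinear function of lists of \<open>p\<close> polynomials.
\<close>

type_synonym 'g bcochain = "spoly list \<Rightarrow> 'g skew"

definition SVlists :: "nat \<Rightarrow> nat \<Rightarrow> spoly list set" where
  "SVlists n p = {fs. length fs = p \<and> set fs \<subseteq> SV n}"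

definition bcochains :: "nat \<Rightarrow> 'g \<Rightarrow> nat \<Rightarrow> 'g bcochain set" where
  "bcochains n g p =
     {\<phi>. \<forall>fs\<in>SVlists n p. \<phi> fs \<in> Sbar n g \<and>
        (\<forall>k<p. \<forall>f\<in>SV n. \<forall>h\<in>SV n. \<forall>c.
           \<phi> (fs[k := f + h]) = \<phi> (fs[k := f]) + \<phi> (fs[k := h]) \<and>
           \<phi> (fs[k := cst c * f]) = cscale c (\<phi> (fs[k := f])))}"

text \<open>
  The \<open>S(V)\<^sup>e\<close>-linear map \<open>F\<close> on the bar resolution with \<open>F (1 \<otimes> f\<^sub>1 \<otimes> ... \<otimes> f\<^sub>p \<otimes> 1) = \<phi> [f\<^sub>1, ..., f\<^sub>p]\<close>.
\<close>

definition bar_hom ::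
  "('g, 'm) monoid_scheme \<Rightarrow> ('g \<Rightarrow> spoly \<Rightarrow> spoly) \<Rightarrow> 'g bcochain \<Rightarrow> stens \<Rightarrow> 'g skew" where
  "bar_hom G A \<phi> t =
     (\<Sum>ms\<in>Poly_Mapping.keys t.
        env_act G A (Poly_Mapping.single (hd ms, last ms) (Poly_Mapping.lookup t ms))
          (\<phi> (map xmon (butlast (tl ms)))))"

definition bar_codiff ::
  "('g, 'm) monoid_scheme \<Rightarrow> ('g \<Rightarrow> spoly \<Rightarrow> spoly) \<Rightarrow> nat \<Rightarrow> 'g bcochain \<Rightarrow> 'g bcochain" where
  "bar_codiff G A p \<phi> fs = bar_hom G A \<phi> (bar_d (p + 1) (ptens (1 # fs @ [1])))"

text \<open>
  Linear maps, one in each degree, from Koszul cochains to bar cochains that commute with the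
  differentials.
\<close>

definition is_cochain_map ::
  "('g, 'm) monoid_scheme \<Rightarrow> ('g \<Rightarrow> spoly \<Rightarrow> spoly) \<Rightarrow> nat \<Rightarrow> 'g \<Rightarrow>
     (nat \<Rightarrow> 'g kcochain \<Rightarrow> 'g bcochain) \<Rightarrow> bool" where
  "is_cochain_map G A n g \<Theta> \<longleftrightarrow>
     (\<forall>p. \<forall>\<alpha>\<in>kcochains n g p.
        \<Theta> p \<alpha> \<in> bcochains n g p \<and>
        (\<forall>\<beta>\<in>kcochains n g p. \<forall>fs\<in>SVlists n p. \<Theta> p (\<alpha> + \<beta>) fs = \<Theta> p \<alpha> fs + \<Theta> p \<beta> fs) \<and>
        (\<forall>c. \<forall>fs\<in>SVlists n p. \<Theta> p (Poly_Mapping.map (cscale c) \<alpha>) fs = cscale c (\<Theta> p \<alpha> fs)) \<and>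
        kos_codiff G A n p \<alpha> \<in> kcochains n g (p + 1) \<and>
        (\<forall>fs\<in>SVlists n (p + 1).
           bar_codiff G A p (\<Theta> p \<alpha>) fs = \<Theta> (p + 1) (kos_codiff G A n p \<alpha>) fs))"


section \<open>The chain map \<open>\<Psi>\<close> and its dual\<close>

text \<open>
  For \<open>L = [\<ell>\<^sup>1, ..., \<ell>\<^sup>p]\<close>, \<open>I = [i\<^sub>1, ..., i\<^sub>p]\<close> increasing, and \<open>a k\<close> standing for \<open>a\<^sub>i\<^sub>k\<close> (positions
  counted from \<open>0\<close>).  Because \<open>I\<close> is increasing, \<open>\<ell>\<^sup>1\<^sub>i + ... + \<ell>\<^sup>j\<^sup>-\<^sup>1\<^sub>i\<close> for \<open>i = i\<^sub>j\<close> and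
  \<open>\<ell>\<^sup>1\<^sub>i + ... + \<ell>\<^sup>j\<^sub>i\<close> for \<open>i\<^sub>j < i < i\<^sub>j\<^sub>+\<^sub>1\<close> are both the sum of the \<open>\<ell>\<^sup>k\<^sub>i\<close> over all \<open>k\<close> with \<open>i\<^sub>k < i\<close>;
  in the first case \<open>a\<^sub>i\<close> is added.
\<close>

definition Qexp :: "nat \<Rightarrow> nat \<Rightarrow> mon list \<Rightarrow> nat list \<Rightarrow> (nat \<Rightarrow> nat) \<Rightarrow> mon" where
  "Qexp n p L I a =
     (\<Sum>i\<in>{1..n}. Poly_Mapping.single i
        ((\<Sum>k\<in>{k. k < p \<and> I ! k = i}. a k) +
         (\<Sum>k\<in>{k. k < p \<and> I ! k < i}. Poly_Mapping.lookup (L ! k) i)))"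

text \<open>
  The complementary exponent.  For the \<open>a\<close> occurring in \<open>psi\<close> the subtraction is a genuine one
  (never truncated).
\<close>

definition Qhat :: "nat \<Rightarrow> nat \<Rightarrow> mon list \<Rightarrow> nat list \<Rightarrow> (nat \<Rightarrow> nat) \<Rightarrow> mon" where
  "Qhat n p L I a =
     sum_list L - (Qexp n p L I a + sum_list (map (\<lambda>i. Poly_Mapping.single i 1) I))"

text \<open>
  \<open>\<Psi>\<^sub>p\<close>, to be used on tensors of length \<open>p + 2\<close>: the first and last tensor factor are moved into the
  enveloping algebra by \<open>S(V)\<^sup>e\<close>-linearity.  For \<open>p = 0\<close> the formula is the identity of
  \<open>S(V) \<otimes> S(V)\<close>, see \<open>psi_0\<close> below.
\<close>

definition psi :: "nat \<Rightarrow> nat \<Rightarrow> stens \<Rightarrow> kosz" where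
  "psi n p t =
     (\<Sum>ms\<in>Poly_Mapping.keys t. \<Sum>I\<in>inc n p.
        let L = butlast (tl ms) in
        Poly_Mapping.single I
          (Poly_Mapping.single (hd ms, last ms) (Poly_Mapping.lookup t ms) *
            (\<Sum>a\<in>(\<Pi>\<^sub>E k\<in>{..<p}. {..<Poly_Mapping.lookup (L ! k) (I ! k)}).
               Poly_Mapping.single (Qexp n p L I a, Qhat n p L I a) 1)))"

lemma psi_0: "psi n 0 (Poly_Mapping.single [a, b] c) = Poly_Mapping.single [] (Poly_Mapping.single (a, b) c)"
proof -
  have "inc n 0 = {[]}"
    by (auto simp: inc_def)
  moreover have "Qexp n 0 [] [] x = 0" "Qhat n 0 [] [] x = 0" for x
    by (simp_all add: Qexp_def Qhat_def)
  ultimately show ?thesis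
    by (cases "c = 0")
      (simp_all add: psi_def mult_single flip: zero_prod_def)
qed

definition psi_star ::
  "('g, 'm) monoid_scheme \<Rightarrow> ('g \<Rightarrow> spoly \<Rightarrow> spoly) \<Rightarrow> nat \<Rightarrow> nat \<Rightarrow> 'g kcochain \<Rightarrow> 'g bcochain" where
  "psi_star G A n p \<alpha> fs = kos_hom G A \<alpha> (psi n p (ptens (1 # fs @ [1])))"


section \<open>The map \<open>\<Upsilon>\<close>\<close>

definition refl_map ::
  "(complex \<Rightarrow> 'v \<Rightarrow> 'v) \<Rightarrow> nat \<Rightarrow> (nat \<Rightarrow> 'v::ab_group_add) \<Rightarrow> (nat \<Rightarrow> complex) \<Rightarrow> nat \<Rightarrow> 'v \<Rightarrow> 'v" where
  "refl_map scale n v \<epsilon> i w =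
     (\<Sum>j\<in>{1..n}. scale ((if j = i then \<epsilon> j else 1) * coord scale n v w j) (v j))"

text \<open>The product \<open>s\<^sub>1 s\<^sub>2 ... s\<^sub>j\<^sub>-\<^sub>1\<close> in \<open>GL(V)\<close>.\<close>

definition refl_prod ::
  "(complex \<Rightarrow> 'v \<Rightarrow> 'v) \<Rightarrow> nat \<Rightarrow> (nat \<Rightarrow> 'v::ab_group_add) \<Rightarrow> (nat \<Rightarrow> complex) \<Rightarrow> nat \<Rightarrow> 'v \<Rightarrow> 'v" where
  "refl_prod scale n v \<epsilon> j = foldr (\<lambda>i T. refl_map scale n v \<epsilon> i \<circ> T) [1..<j] id"

definition partial_deriv :: "nat \<Rightarrow> spoly \<Rightarrow> spoly" where
  "partial_deriv i f =
     (\<Sum>m\<in>Poly_Mapping.keys f.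
        Poly_Mapping.single (m - Poly_Mapping.single i 1)
          (of_nat (Poly_Mapping.lookup m i) * Poly_Mapping.lookup f m))"

text \<open>
  The quotient \<open>(f - s\<^sub>i f) / (v\<^sub>i - s\<^sub>i v\<^sub>i)\<close> is unique because polynomials form an integral domain,
  and exists for every \<open>f\<close> in \<open>S(V)\<close>.
\<close>

definition qderiv ::
  "(complex \<Rightarrow> 'v \<Rightarrow> 'v) \<Rightarrow> nat \<Rightarrow> (nat \<Rightarrow> 'v::ab_group_add) \<Rightarrow> (nat \<Rightarrow> complex) \<Rightarrow> nat \<Rightarrow> spoly \<Rightarrow> spoly" where
  "qderiv scale n v \<epsilon> i f =
     (if \<epsilon> i = 1 then partial_deriv i f
      else THE q. q * (emb scale n v (v i) - emb scale n v (refl_map scale n v \<epsilon> i (v i))) =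
                  f - symext scale n v (refl_map scale n v \<epsilon> i) f)"

definition upsilon ::
  "('g, 'm) monoid_scheme \<Rightarrow> ('g \<Rightarrow> spoly \<Rightarrow> spoly) \<Rightarrow>
     (complex \<Rightarrow> 'v \<Rightarrow> 'v) \<Rightarrow> nat \<Rightarrow> (nat \<Rightarrow> 'v::ab_group_add) \<Rightarrow> (nat \<Rightarrow> complex) \<Rightarrow>
     nat \<Rightarrow> 'g kcochain \<Rightarrow> 'g bcochain" where
  "upsilon G A scale n v \<epsilon> p \<alpha> fs =
     (\<Sum>J\<in>Poly_Mapping.keys \<alpha>.
        skew_mult G A
          (incl G (\<Prod>k<p. symext scale n v (refl_prod scale n v \<epsilon> (J ! k))
                                        (qderiv scale n v \<epsilon> (J ! k) (fs ! k))))
          (Poly_Mapping.lookup \<alpha> J))"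

end

theory Submission
  imports Defs
begin

text \<open>
  Write \<open>T\<^sub>j = s\<^sub>1 \<dots> s\<^sub>j\<^sub>-\<^sub>1\<close> and \<open>D\<^sub>j = T\<^sub>j \<circ> \<partial>\<^sub>j\<close>.  In the eigenbasis \<open>T\<^sub>j\<close> multiplies a monomial by a
  scalar, its weight, and \<open>D\<^sub>j\<close> lowers the exponent of \<open>v\<^sub>j\<close> by one and multiplies by a weight and by
  the \<open>q\<close>-integer \<open>1 + q + \<dots> + q\<^bsup>\<ell>-1\<^esup>\<close>, where \<open>q = \<epsilon>\<^sub>j\<close> and \<open>\<ell>\<close> is the exponent of \<open>v\<^sub>j\<close>.  This holds for
  \<open>\<epsilon>\<^sub>j = 1\<close> as well, the \<open>q\<close>-integer then being \<open>\<ell>\<close> itself.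

  The two maps agree because both values are multilinear, so that arguments may be taken to be
  monomials, and on monomials both can be computed.  The cochain pulled back along \<open>\<Psi>\<close> multiplies
  \<open>f g\<close> by \<open>v\<^sup>Q\<close> on the left and by \<open>v\<^bsup>Q'\<^esup>\<close> on the right, where \<open>Q'\<close> is the complementary exponent; moving
  the right factor past \<open>g\<close> costs the weight of \<open>Q'\<close> under \<open>g\<close>.  The monomial \<open>v\<^bsup>Q + Q'\<^esup>\<close> is the same for
  all choices of the integers \<open>a\<^sub>i\<close>, and the weight of \<open>Q'\<close> is a
  product of one factor for each tensor position, depending only on the \<open>a\<^sub>i\<close> of that position
  (\<open>Qexp_Qhat\<close>, \<open>weight_Qhat\<close>).  Hence the sum over all \<open>a\<^sub>i\<close> is a product of geometric sums, which are
  the \<open>q\<close>-integers in the operators \<open>D\<^sub>j\<close> (\<open>sum_sandwich_Q\<close>).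

  The compatibility with the differentials rests on two identities: the twisted Leibniz rule
  \<open>D\<^sub>j (a b) = D\<^sub>j a \<cdot> T\<^sub>j\<^sub>+\<^sub>1 b + T\<^sub>j a \<cdot> D\<^sub>j b\<close>, and \<open>(v\<^sub>j - \<^sup>gv\<^sub>j) D\<^sub>j = T\<^sub>j - T\<^sub>j\<^sub>+\<^sub>1\<close>, which for \<open>\<epsilon>\<^sub>j \<noteq> 1\<close> says
  that \<open>\<partial>\<^sub>j\<close> is a difference quotient and for \<open>\<epsilon>\<^sub>j = 1\<close> reads \<open>0 = 0\<close>.  A Koszul coboundary inserts an index \<open>m\<close> into an increasing list, with the
  factor \<open>v\<^sub>m - \<^sup>gv\<^sub>m\<close>.  By the second identity the sum over all \<open>m\<close> in a gap of the list telescopes to its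
  two end terms.  By the first identity the end terms of two neighbouring gaps combine to the term of
  the bar coboundary in which two neighbouring arguments are multiplied.  The two outermost ends are
  \<open>T\<^sub>1\<close>, the identity, and \<open>T\<^sub>n\<^sub>+\<^sub>1\<close>, the action of \<open>g\<close>; they are the outer terms of the bar coboundary.  The
  argument is carried out in \<open>ordered_sum_koszul_diff\<close> for arbitrary families satisfying the two
  identities.
\<close>

section \<open>Linear extension from a monomial basis\<close>

text \<open>
  Algebra endomorphisms and twisted derivations of \<open>S(V)\<close>, evaluations of tensors, and actions of the
  enveloping algebra are all determined by their values on a basis of monomials, lists of monomials, or
  pairs of monomials.  They are treated uniformly as instances of this linear extension.
\<close>

definition lin_ext :: "('a \<Rightarrow> spoly) \<Rightarrow> ('a \<Rightarrow>\<^sub>0 complex) \<Rightarrow> spoly" where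
  "lin_ext \<Phi> t = (\<Sum>m\<in>Poly_Mapping.keys t. cst (Poly_Mapping.lookup t m) * \<Phi> m)"

lemma cst_0 [simp]: "cst 0 = 0"
  by (simp add: cst_def)

lemma cst_1 [simp]: "cst 1 = 1"
  by (simp add: cst_def)

lemma cst_add: "cst (a + b) = cst a + cst b"
  by (simp add: cst_def single_add)

lemma cst_diff: "cst (a - b) = cst a - cst b"
  by (simp add: cst_def single_diff)

lemma cst_mult: "cst (a * b) = cst a * cst b"
  by (simp add: cst_def mult_single)

lemma cst_power: "cst (a ^ k) = cst a ^ k"
  by (induction k) (simp_all add: cst_mult)

lemma cst_minus_one_power: "cst ((-1) ^ k) = (-1) ^ k"
  using cst_diff[of 0 1] by (simp add: cst_power)

lemma cst_sum: "cst (sum f A) = (\<Sum>x\<in>A. cst (f x))"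
  by (induction A rule: infinite_finite_induct) (simp_all add: cst_add)

lemma cst_prod: "cst (prod f A) = (\<Prod>x\<in>A. cst (f x))"
  by (induction A rule: infinite_finite_induct) (simp_all add: cst_mult)

lemma xmon_0 [simp]: "xmon 0 = 1"
  by (simp add: xmon_def)

lemma xmon_add: "xmon (a + b) = xmon a * xmon b"
  by (simp add: xmon_def mult_single)

lemma xmon_sum: "xmon (sum f A) = (\<Prod>x\<in>A. xmon (f x))"
  by (induction A rule: infinite_finite_induct) (simp_all add: xmon_add)

lemma cst_mult_xmon: "cst c * xmon m = Poly_Mapping.single m c"
  by (simp add: cst_def xmon_def mult_single)

lemma xvar_power: "xvar i ^ k = xmon (Poly_Mapping.single i k)"
  by (induction k) (simp_all add: xvar_def flip: xmon_add single_add)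

lemma sum_single_lookup:
  "(\<Sum>m\<in>Poly_Mapping.keys t. Poly_Mapping.single m (Poly_Mapping.lookup t m)) = t"
  by (rule poly_mapping_eqI)
    (simp add: lookup_sum lookup_single when_def sum.delta' in_keys_iff cong: if_cong)

lemma lin_ext_add: "lin_ext \<Phi> (s + t) = lin_ext \<Phi> s + lin_ext \<Phi> t"
  unfolding lin_ext_def by (rule setsum_keys_plus_distrib) (simp_all add: cst_add algebra_simps)

lemma lin_ext_0 [simp]: "lin_ext \<Phi> 0 = 0"
  by (simp add: lin_ext_def)

lemma lin_ext_sum: "lin_ext \<Phi> (sum f A) = (\<Sum>x\<in>A. lin_ext \<Phi> (f x))"
  by (induction A rule: infinite_finite_induct) (simp_all add: lin_ext_add)

lemma lin_ext_uminus: "lin_ext \<Phi> (- t) = - lin_ext \<Phi> t"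
  using lin_ext_add[of \<Phi> t "- t"] by (simp add: minus_unique)

lemma lin_ext_diff: "lin_ext \<Phi> (s - t) = lin_ext \<Phi> s - lin_ext \<Phi> t"
  using lin_ext_add[of \<Phi> s "- t"] by (simp add: lin_ext_uminus)

lemma lin_ext_single [simp]: "lin_ext \<Phi> (Poly_Mapping.single m c) = cst c * \<Phi> m"
  by (simp add: lin_ext_def)

lemma lin_ext_xmon [simp]: "lin_ext \<Phi> (xmon m) = \<Phi> m"
  by (simp add: xmon_def)

lemma lin_ext_one: "lin_ext \<Phi> 1 = \<Phi> 0"
  by (simp add: lin_ext_def)

lemma lin_ext_cong:
  assumes "\<And>m. m \<in> Poly_Mapping.keys t \<Longrightarrow> \<Phi> m = \<Psi> m"
  shows "lin_ext \<Phi> t = lin_ext \<Psi> t"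
  using assms by (simp add: lin_ext_def)

lemma lin_ext_xmon_id: "lin_ext xmon f = f"
  by (simp add: lin_ext_def cst_mult_xmon sum_single_lookup)

lemma lin_ext_cst_mult: "lin_ext \<Phi> (cst c * f) = cst c * lin_ext \<Phi> f"
proof -
  have "cst c * f = (\<Sum>m\<in>Poly_Mapping.keys f. Poly_Mapping.single m (c * Poly_Mapping.lookup f m))"
    by (subst (1) lin_ext_xmon_id[of f, symmetric])
      (simp add: lin_ext_def sum_distrib_left cst_mult mult.assoc flip: cst_mult_xmon)
  thus ?thesis
    by (simp add: lin_ext_sum cst_mult mult.assoc flip: sum_distrib_left)
      (simp add: lin_ext_def)
qed

lemma lin_ext_lin_ext: "lin_ext \<Phi> (lin_ext \<Psi> t) = lin_ext (\<lambda>m. lin_ext \<Phi> (\<Psi> m)) t"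
  by (simp add: lin_ext_def[of \<Psi>] lin_ext_def[of "\<lambda>m. lin_ext \<Phi> (\<Psi> m)"] lin_ext_sum lin_ext_cst_mult)

lemma lin_ext_mult_right: "lin_ext (\<lambda>m. \<Phi> m * r) t = lin_ext \<Phi> t * r"
  by (simp add: lin_ext_def sum_distrib_right mult.assoc)

lemma lin_ext_mult_left: "lin_ext (\<lambda>m. r * \<Phi> m) t = r * lin_ext \<Phi> t"
  by (simp add: lin_ext_def sum_distrib_left algebra_simps)

lemma lin_ext_sum_fun: "lin_ext (\<lambda>m. \<Sum>x\<in>A. \<Phi> x m) t = (\<Sum>x\<in>A. lin_ext (\<Phi> x) t)"
  unfolding lin_ext_def sum_distrib_left by (rule sum.swap)

lemma lin_ext_diff_fun: "lin_ext (\<lambda>m. \<Phi> m - \<Psi> m) t = lin_ext \<Phi> t - lin_ext \<Psi> t"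
  by (simp add: lin_ext_def algebra_simps sum_subtractf)

section \<open>Linear maps on tensor powers\<close>

lemma lin_ext_ptens_Cons:
  "lin_ext \<Phi> (ptens (f # fs)) = lin_ext (\<lambda>m. lin_ext (\<lambda>L. \<Phi> (m # L)) (ptens fs)) f"
  by (simp add: lin_ext_sum cst_mult)
    (simp add: lin_ext_def sum_distrib_left mult.assoc)

lemma lin_ext_ptens_snoc_one:
  "lin_ext \<Phi> (ptens (fs @ [1])) = lin_ext (\<lambda>L. \<Phi> (L @ [0])) (ptens fs)"
proof (induction fs arbitrary: \<Phi>)
  case Nil
  have "lin_ext \<Phi> (ptens [1]) = lin_ext (\<lambda>m. lin_ext (\<lambda>L. \<Phi> (m # L)) (ptens [])) 1"
    by (rule lin_ext_ptens_Cons)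
  thus ?case by (simp add: lin_ext_one)
next
  case (Cons f fs)
  show ?case
    unfolding append_Cons lin_ext_ptens_Cons Cons.IH ..
qed

text \<open>
  The identification of bimodule maps on the bar resolution with multilinear maps is
  \<open>F \<mapsto> F(1 \<otimes> - \<otimes> 1)\<close>; on lists of monomials the two unit factors become zero exponents.
\<close>

lemma lin_ext_ptens_units:
  "lin_ext \<Phi> (ptens (1 # fs @ [1])) = lin_ext (\<lambda>L. \<Phi> (0 # L @ [0])) (ptens fs)"
  unfolding lin_ext_ptens_Cons lin_ext_ptens_snoc_one lin_ext_one ..

text \<open>
  This is what turns a statement about lists of monomials into one about arbitrary pure tensors: a
  product of functions of the single entries extends to the product of their linear extensions.
\<close>

lemma lin_ext_ptens_prod:
  "lin_ext (\<lambda>L. \<Prod>k<length fs. \<Phi> k (L ! k)) (ptens fs) = (\<Prod>k<length fs. lin_ext (\<Phi> k) (fs ! k))"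
proof (induction fs arbitrary: \<Phi>)
  case Nil
  show ?case by simp
next
  case (Cons f fs)
  have "lin_ext (\<lambda>L. \<Prod>k<length (f # fs). \<Phi> k (L ! k)) (ptens (f # fs)) =
      lin_ext (\<Phi> 0) f * lin_ext (\<lambda>L. \<Prod>k<length fs. \<Phi> (Suc k) (L ! k)) (ptens fs)"
    unfolding lin_ext_ptens_Cons
    by (simp add: prod.lessThan_Suc_shift lin_ext_mult_left lin_ext_mult_right del: prod.lessThan_Suc)
  thus ?case
    unfolding Cons.IH[of "\<lambda>k. \<Phi> (Suc k)"] by (simp add: prod.lessThan_Suc_shift del: prod.lessThan_Suc)
qed

lemma keys_ptens:
  "L \<in> Poly_Mapping.keys (ptens fs) \<Longrightarrow> list_all2 (\<lambda>m f. m \<in> Poly_Mapping.keys f) L fs"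
proof (induction fs arbitrary: L)
  case Nil
  thus ?case by (simp split: if_splits)
next
  case (Cons f fs)
  have "Poly_Mapping.keys (ptens (f # fs)) \<subseteq>
      (\<Union>m\<in>Poly_Mapping.keys f. \<Union>ms\<in>Poly_Mapping.keys (ptens fs). {m # ms})"
    unfolding ptens.simps
    by (intro order.trans[OF keys_sum] UN_mono order_refl) (auto split: if_splits)
  with Cons show ?case by auto
qed

section \<open>Closure properties of the symmetric algebra\<close>

lemma mons_add: "a \<in> mons n \<Longrightarrow> b \<in> mons n \<Longrightarrow> a + b \<in> mons n"
  using keys_add[of a b] by (auto simp: mons_def)

lemma mons_diff: "a \<in> mons n \<Longrightarrow> a - b \<in> mons n"
  by (auto simp: mons_def in_keys_iff lookup_minus subset_iff)

lemma mons_single: "i \<in> {1..n} \<Longrightarrow> Poly_Mapping.single i k \<in> mons n"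
  by (simp add: mons_def)

lemma mons_sum_list: "set L \<subseteq> mons n \<Longrightarrow> sum_list L \<in> mons n"
  by (induction L) (auto intro: mons_add, simp add: mons_def)

lemma SV_0 [simp]: "0 \<in> SV n" and SV_1 [simp]: "1 \<in> SV n"
  by (simp_all add: SV_def mons_def)

lemma SV_cst [simp]: "cst c \<in> SV n"
  by (simp add: SV_def cst_def mons_def)

lemma SV_xmon: "m \<in> mons n \<Longrightarrow> xmon m \<in> SV n"
  by (simp add: SV_def xmon_def)

lemma SV_add: "f \<in> SV n \<Longrightarrow> h \<in> SV n \<Longrightarrow> f + h \<in> SV n"
  using keys_add[of f h] by (auto simp: SV_def)

lemma SV_mult: "f \<in> SV n \<Longrightarrow> h \<in> SV n \<Longrightarrow> f * h \<in> SV n"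
  using keys_mult[of f h] by (fastforce simp: SV_def intro: mons_add)

lemma SV_sum: "(\<And>x. x \<in> A \<Longrightarrow> f x \<in> SV n) \<Longrightarrow> sum f A \<in> SV n"
  by (induction A rule: infinite_finite_induct) (auto intro: SV_add)

lemma SV_prod: "(\<And>x. x \<in> A \<Longrightarrow> f x \<in> SV n) \<Longrightarrow> prod f A \<in> SV n"
  by (induction A rule: infinite_finite_induct) (auto intro: SV_mult)

lemma SV_lin_ext:
  "(\<And>m. m \<in> Poly_Mapping.keys t \<Longrightarrow> \<Phi> m \<in> SV n) \<Longrightarrow> lin_ext \<Phi> t \<in> SV n"
  unfolding lin_ext_def by (intro SV_sum SV_mult SV_cst)

lemma keys_SV: "f \<in> SV n \<Longrightarrow> m \<in> Poly_Mapping.keys f \<Longrightarrow> m \<in> mons n"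
  by (auto simp: SV_def)

lemma keys_ptens_SV:
  assumes "fs \<in> SVlists n p" "L \<in> Poly_Mapping.keys (ptens fs)"
  shows "length L = p" "set L \<subseteq> mons n"
  using keys_ptens[OF assms(2)] assms(1)
  by (fastforce simp: SVlists_def list_all2_conv_all_nth in_set_conv_nth SV_def)+

section \<open>Products of reflections and twisted derivations on monomials\<close>

text \<open>
  The eigenvalue of a monomial under the algebra endomorphism scaling \<open>v\<^sub>i\<close> by \<open>w i\<close>.
\<close>

definition weight :: "nat \<Rightarrow> (nat \<Rightarrow> complex) \<Rightarrow> mon \<Rightarrow> complex" where
  "weight n w m = (\<Prod>i\<in>{1..n}. w i ^ Poly_Mapping.lookup m i)"

definition qnum :: "complex \<Rightarrow> nat \<Rightarrow> complex" where
  "qnum q k = (\<Sum>b<k. q ^ b)"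

text \<open>
  The scalars by which \<open>s\<^sub>1 \<dots> s\<^sub>j\<^sub>-\<^sub>1\<close> acts on the basis vectors.
\<close>

definition refl_weights :: "(nat \<Rightarrow> complex) \<Rightarrow> nat \<Rightarrow> nat \<Rightarrow> complex" where
  "refl_weights \<epsilon> j i = (if i < j then \<epsilon> i else 1)"

text \<open>
  The operators \<open>T\<^sub>j = s\<^sub>1 \<dots> s\<^sub>j\<^sub>-\<^sub>1\<close> and \<open>D\<^sub>j = T\<^sub>j \<circ> \<partial>\<^sub>j\<close> on monomials.  In \<open>twisted_deriv\<close> the weight is
  that of the full monomial, which is correct because \<open>T\<^sub>j\<close> fixes \<open>v\<^sub>j\<close>.  The truncated subtraction in
  \<open>twisted_deriv\<close> is harmless: if \<open>v\<^sub>j\<close> does not divide the monomial, then the \<open>q\<close>-integer vanishes.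
\<close>

definition twist :: "nat \<Rightarrow> (nat \<Rightarrow> complex) \<Rightarrow> nat \<Rightarrow> mon \<Rightarrow> spoly" where
  "twist n \<epsilon> j m = cst (weight n (refl_weights \<epsilon> j) m) * xmon m"

definition twisted_deriv :: "nat \<Rightarrow> (nat \<Rightarrow> complex) \<Rightarrow> nat \<Rightarrow> mon \<Rightarrow> spoly" where
  "twisted_deriv n \<epsilon> j m = cst (weight n (refl_weights \<epsilon> j) m * qnum (\<epsilon> j) (Poly_Mapping.lookup m j)) *
     xmon (m - Poly_Mapping.single j 1)"

lemma weight_add: "weight n w (a + b) = weight n w a * weight n w b"
  by (simp add: weight_def lookup_add power_add prod.distrib)

lemma weight_single: "i \<in> {1..n} \<Longrightarrow> weight n w (Poly_Mapping.single i k) = w i ^ k"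
  by (simp add: weight_def lookup_single when_def if_distrib[of "\<lambda>k. _ ^ k"] prod.delta' cong: if_cong)

lemma qnum_0 [simp]: "qnum q 0 = 0"
  by (simp add: qnum_def)

lemma qnum_add: "qnum q (a + b) = qnum q a * q ^ b + qnum q b"
  by (induction a) (simp_all add: qnum_def algebra_simps power_add)

lemma qnum_mult: "(1 - q) * qnum q k = 1 - q ^ k"
  by (simp add: qnum_def one_diff_power_eq)

lemma qnum_eq_1: "qnum 1 k = of_nat k"
  by (simp add: qnum_def)

lemma weight_refl_weights_Suc:
  assumes "j \<in> {1..n}"
  shows "weight n (refl_weights \<epsilon> (Suc j)) m = weight n (refl_weights \<epsilon> j) m * \<epsilon> j ^ Poly_Mapping.lookup m j"
proof -
  have "weight n (refl_weights \<epsilon> (Suc j)) m =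
      (\<Prod>i\<in>{1..n}. refl_weights \<epsilon> j i ^ Poly_Mapping.lookup m i *
         (if i = j then \<epsilon> j ^ Poly_Mapping.lookup m j else 1))"
    unfolding weight_def by (intro prod.cong) (auto simp: refl_weights_def less_Suc_eq)
  thus ?thesis
    using assms by (simp add: weight_def prod.distrib)
qed

lemma weight_refl_weights_one [simp]: "weight n (refl_weights \<epsilon> (Suc 0)) m = 1"
  by (simp add: weight_def refl_weights_def)

lemma weight_refl_weights_last [simp]: "weight n (refl_weights \<epsilon> (Suc n)) m = weight n \<epsilon> m"
  unfolding weight_def by (intro prod.cong) (auto simp: refl_weights_def)

lemma diff_single_add:
  fixes a :: mon
  assumes "Poly_Mapping.lookup a j > 0"
  shows "a - Poly_Mapping.single j 1 + Poly_Mapping.single j 1 = a"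
  using assms by (intro poly_mapping_eqI) (auto simp: lookup_add lookup_minus lookup_single when_def)

lemma add_diff_single:
  fixes a :: mon
  assumes "Poly_Mapping.lookup a j > 0"
  shows "a + b - Poly_Mapping.single j 1 = (a - Poly_Mapping.single j 1) + b"
  using assms by (intro poly_mapping_eqI) (auto simp: lookup_add lookup_minus lookup_single when_def)

text \<open>
  The twisted Leibniz rule: it comes from \<open>[k + l]\<^sub>q = [k]\<^sub>q q\<^sup>l + [l]\<^sub>q\<close>, the power \<open>q\<^sup>l\<close> being the weight that
  distinguishes \<open>T\<^sub>j\<^sub>+\<^sub>1\<close> from \<open>T\<^sub>j\<close>.
\<close>

lemma twisted_deriv_add:
  assumes "j \<in> {1..n}"
  shows "twisted_deriv n \<epsilon> j (a + b) = twisted_deriv n \<epsilon> j a * twist n \<epsilon> (Suc j) b + twist n \<epsilon> j a * twisted_deriv n \<epsilon> j b"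
proof -
  let ?e = "Poly_Mapping.single j (1::nat)"
  let ?w = "weight n (refl_weights \<epsilon> j)"
  let ?q = "\<lambda>m. qnum (\<epsilon> j) (Poly_Mapping.lookup m j)"
  have 1: "cst (?q a) * xmon (a + b - ?e) = cst (?q a) * (xmon (a - ?e) * xmon b)"
    by (cases "Poly_Mapping.lookup a j = 0") (simp_all add: add_diff_single[of a j b] xmon_add del: One_nat_def)
  have 2: "cst (?q b) * xmon (a + b - ?e) = cst (?q b) * (xmon a * xmon (b - ?e))"
    by (cases "Poly_Mapping.lookup b j = 0")
      (simp_all add: add_diff_single[of b j a] xmon_add add.commute[of a b] mult.commute del: One_nat_def)
  have "twisted_deriv n \<epsilon> j (a + b) = cst (?w a * ?w b * \<epsilon> j ^ Poly_Mapping.lookup b j) * (cst (?q a) * xmon (a + b - ?e))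
      + cst (?w a * ?w b) * (cst (?q b) * xmon (a + b - ?e))"
    by (simp add: twisted_deriv_def weight_add lookup_add qnum_add cst_mult cst_add algebra_simps)
  also have "\<dots> = twisted_deriv n \<epsilon> j a * twist n \<epsilon> (Suc j) b + twist n \<epsilon> j a * twisted_deriv n \<epsilon> j b"
    unfolding 1 2 by (simp add: twisted_deriv_def twist_def weight_refl_weights_Suc[OF assms] cst_mult algebra_simps)
  finally show ?thesis .
qed

text \<open>
  The difference quotient property, from \<open>(1 - q) [k]\<^sub>q = 1 - q\<^sup>k\<close>.
\<close>

lemma xvar_mult_twisted_deriv:
  assumes "j \<in> {1..n}"
  shows "cst (1 - \<epsilon> j) * xvar j * twisted_deriv n \<epsilon> j m = twist n \<epsilon> j m - twist n \<epsilon> (Suc j) m"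
proof -
  let ?k = "Poly_Mapping.lookup m j"
  have *: "cst (qnum (\<epsilon> j) ?k) * (xvar j * xmon (m - Poly_Mapping.single j 1)) =
      cst (qnum (\<epsilon> j) ?k) * xmon m"
    by (cases "?k = 0") (simp_all add: xvar_def add.commute[of "Poly_Mapping.single j 1"] diff_single_add[of m j]
          del: One_nat_def flip: xmon_add)
  have "cst (1 - \<epsilon> j) * xvar j * twisted_deriv n \<epsilon> j m = cst (weight n (refl_weights \<epsilon> j) m) * cst (1 - \<epsilon> j) *
      (cst (qnum (\<epsilon> j) ?k) * (xvar j * xmon (m - Poly_Mapping.single j 1)))"
    by (simp only: twisted_deriv_def cst_mult ac_simps)
  also have "\<dots> = cst (weight n (refl_weights \<epsilon> j) m * ((1 - \<epsilon> j) * qnum (\<epsilon> j) ?k)) * xmon m"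
    unfolding * by (simp only: cst_mult ac_simps)
  also have "\<dots> = twist n \<epsilon> j m - twist n \<epsilon> (Suc j) m"
    unfolding qnum_mult by (simp add: twist_def weight_refl_weights_Suc[OF assms] cst_mult cst_diff algebra_simps)
  finally show ?thesis .
qed

section \<open>Telescoping over increasing index lists\<close>

text \<open>
  The sum of \<open>D\<^sub>k\<^sub>1 a\<^sub>1 \<cdots> D\<^sub>k\<^sub>p a\<^sub>p \<cdot> F [k\<^sub>1, \<dots>, k\<^sub>p]\<close> over all \<open>lo < k\<^sub>1 < \<dots> < k\<^sub>p \<le> n\<close>.  The recursion on the
  smallest index, with a variable lower bound, is what makes the telescoping argument an induction.
\<close>

fun ordered_sum :: "(nat \<Rightarrow> 'x \<Rightarrow> 'r::comm_ring_1) \<Rightarrow> nat \<Rightarrow> nat \<Rightarrow> 'x list \<Rightarrow> (nat list \<Rightarrow> 'r) \<Rightarrow> 'r" where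
  "ordered_sum D n lo [] F = F []"
| "ordered_sum D n lo (a # L) F = (\<Sum>k\<in>{lo<..n}. D k a * ordered_sum D n k L (\<lambda>K. F (k # K)))"

definition koszul_diff :: "(nat \<Rightarrow> 'r::comm_ring_1) \<Rightarrow> (nat list \<Rightarrow> 'r) \<Rightarrow> nat list \<Rightarrow> 'r" where
  "koszul_diff y F K = (\<Sum>i<length K. (-1) ^ i * y (K ! i) * F (take i K @ drop (i + 1) K))"

definition merge_at :: "nat \<Rightarrow> 'x::plus list \<Rightarrow> 'x list" where
  "merge_at j L = take j L @ [L ! j + L ! (j + 1)] @ drop (j + 2) L"

text \<open>
  The bar coboundary of \<open>L \<mapsto> ordered_sum D n lo L F\<close> without its first term and with the opposite
  sign.  The map \<open>T\<close> is the action by which the last argument moves past the coefficients.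
\<close>

definition merge_sum ::
  "(nat \<Rightarrow> 'x::plus \<Rightarrow> 'r::comm_ring_1) \<Rightarrow> ('x \<Rightarrow> 'r) \<Rightarrow> nat \<Rightarrow> nat \<Rightarrow> 'x list \<Rightarrow> (nat list \<Rightarrow> 'r) \<Rightarrow> 'r" where
  "merge_sum D T n lo L F =
     (\<Sum>j<length L - 1. (-1) ^ j * ordered_sum D n lo (merge_at j L) F) +
     (-1) ^ (length L - 1) * T (last L) * ordered_sum D n lo (butlast L) F"

lemma inc_above_Suc:
  fixes lo n :: nat
  shows "{J. length J = Suc p \<and> sorted_wrt (<) J \<and> set J \<subseteq> {lo<..n}} =
     (\<lambda>(k, K). k # K) ` (SIGMA k:{lo<..n}. {J. length J = p \<and> sorted_wrt (<) J \<and> set J \<subseteq> {k<..n}})"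
  (is "?A = ?B")
proof
  show "?A \<subseteq> ?B"
  proof
    fix J assume J: "J \<in> ?A"
    then obtain k K where "J = k # K"
      by (cases J) auto
    with J show "J \<in> ?B"
      by (force simp: image_iff)
  qed
  show "?B \<subseteq> ?A"
  proof
    fix J assume "J \<in> ?B"
    then obtain k K where "J = k # K" "k \<in> {lo<..n}" "length K = p" "sorted_wrt (<) K" "set K \<subseteq> {k<..n}"
      by auto
    moreover from this have "set K \<subseteq> {lo<..n}"
      by (intro subset_trans[OF \<open>set K \<subseteq> {k<..n}\<close>]) auto
    ultimately show "J \<in> ?A"
      by auto
  qed
qed

lemma ordered_sum_eq_sum_above:
  "ordered_sum D n lo L F =
     (\<Sum>J\<in>{J. length J = length L \<and> sorted_wrt (<) J \<and> set J \<subseteq> {lo<..n}}.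
        (\<Prod>k<length L. D (J ! k) (L ! k)) * F J)"
proof (induction L arbitrary: lo F)
  case Nil
  have "{J :: nat list. length J = 0 \<and> sorted_wrt (<) J \<and> set J \<subseteq> {lo<..n}} = {[]}"
    by auto
  thus ?case by simp
next
  case (Cons a L)
  let ?S = "\<lambda>lo. {J. length J = length L \<and> sorted_wrt (<) J \<and> set J \<subseteq> {lo<..n}}"
  have fin: "finite (?S k)" for k
    by (rule finite_subset[OF _ finite_lists_length_eq[of "{k<..n}" "length L"]]) auto
  have inj: "inj_on (\<lambda>(k, K). k # K) (SIGMA k:{lo<..n}. ?S k)"
    by (auto simp: inj_on_def)
  show ?case
    unfolding list.size inc_above_Suc add.right_neutral add_Suc_right sum.reindex[OF inj]
    by (simp add: Cons.IH sum.Sigma fin split_def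
        sum_distrib_left prod.lessThan_Suc_shift mult.assoc del: prod.lessThan_Suc)
qed

lemma ordered_sum_eq_sum:
  "ordered_sum D n 0 L F = (\<Sum>J\<in>inc n (length L). (\<Prod>k<length L. D (J ! k) (L ! k)) * F J)"
proof -
  have "{0<..n} = {1..n}" by auto
  thus ?thesis by (simp add: ordered_sum_eq_sum_above inc_def)
qed

lemma ordered_sum_diff:
  "ordered_sum D n lo L (\<lambda>K. F K - H K) = ordered_sum D n lo L F - ordered_sum D n lo L H"
  by (induction L arbitrary: lo F H) (simp_all add: right_diff_distrib sum_subtractf)

lemma ordered_sum_mult:
  "ordered_sum D n lo L (\<lambda>K. c * F K) = c * ordered_sum D n lo L F"
  by (induction L arbitrary: lo F) (simp_all add: algebra_simps sum_distrib_left)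

lemma koszul_diff_Nil [simp]: "koszul_diff y F [] = 0"
  by (simp add: koszul_diff_def)

lemma koszul_diff_Cons:
  "koszul_diff y F (k # K) = y k * F K - koszul_diff y (\<lambda>K. F (k # K)) K"
  unfolding koszul_diff_def length_Cons
  by (simp add: sum.lessThan_Suc_shift sum_negf del: sum.lessThan_Suc)

lemma merge_sum_singleton: "merge_sum D T n lo [a] F = T a * F []"
  by (simp add: merge_sum_def)

text \<open>
  Merging the first two entries is one summand; all other terms leave the first entry alone, so they
  come from the merges of the tail, one position further to the left.
\<close>

lemma merge_sum_Cons_Cons:
  "merge_sum D T n lo (a # b # L) F =
     ordered_sum D n lo ((a + b) # L) F -
     (\<Sum>k\<in>{lo<..n}. D k a * merge_sum D T n k (b # L) (\<lambda>K. F (k # K)))"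
proof -
  let ?M = "b # L" and ?r = "length L"
  have "(\<Sum>k\<in>{lo<..n}. D k a * merge_sum D T n k ?M (\<lambda>K. F (k # K))) =
      (\<Sum>j<?r. (-1) ^ j * ordered_sum D n lo (a # merge_at j ?M) F) +
      (-1) ^ ?r * T (last ?M) * ordered_sum D n lo (a # butlast ?M) F"
    unfolding merge_sum_def
    by (simp add: distrib_left sum.distrib sum_distrib_left algebra_simps del: butlast.simps last.simps)
      (subst sum.swap, simp)
  moreover have "a # merge_at j ?M = merge_at (Suc j) (a # ?M)" for j
    by (simp add: merge_at_def)
  ultimately show ?thesis
    by (simp add: merge_sum_def sum.lessThan_Suc_shift sum_negf merge_at_def[of 0] del: sum.lessThan_Suc)
qed

lemma sum_telescope_above:
  fixes f :: "nat \<Rightarrow> 'r::ab_group_add"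
  shows "lo \<le> n \<Longrightarrow> (\<Sum>k\<in>{lo<..n}. f k - f (Suc k)) = f (Suc lo) - f (Suc n)"
  using sum_Suc_diff[of "Suc lo" n f]
  by (simp add: atLeastSucAtMost_greaterThanAtMost flip: sum_negf)
     (metis (no_types, lifting) minus_diff_eq sum.cong sum_negf)

text \<open>
  A Koszul coboundary is sent to a bar coboundary.  In the induction step the smallest index \<open>k\<close> either
  is the inserted one or stays.  In the first case the sum over \<open>k\<close> telescopes up to the next index \<open>k'\<close>
  and leaves \<open>(T\<^bsub>lo+1\<^esub> a - T\<^bsub>k'\<^esub> a) D\<^bsub>k'\<^esub> b\<close>.  In the second case the induction hypothesis applies with the
  lower bound \<open>k\<close> and contributes \<open>- D\<^bsub>k\<^esub> a T\<^bsub>k+1\<^esub> b\<close>.  The subtracted terms \<open>T\<^bsub>k\<^esub> a D\<^bsub>k\<^esub> b\<close> and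
  \<open>D\<^bsub>k\<^esub> a T\<^bsub>k+1\<^esub> b\<close> add up to \<open>D\<^bsub>k\<^esub> (a + b)\<close>, since the entries are exponents and are written additively.
\<close>

lemma ordered_sum_koszul_diff:
  fixes D T :: "nat \<Rightarrow> 'x::ab_semigroup_add \<Rightarrow> 'r::comm_ring_1"
  assumes derivation: "\<And>k a b. k \<in> {1..n} \<Longrightarrow> D k (a + b) = D k a * T (Suc k) b + T k a * D k b"
    and difference: "\<And>k a. k \<in> {1..n} \<Longrightarrow> y k * D k a = T k a - T (Suc k) a"
    and "lo \<le> n"
  shows "ordered_sum D n lo (a # L) (koszul_diff y F) =
    T (Suc lo) a * ordered_sum D n lo L F - merge_sum D (T (Suc n)) n lo (a # L) F"
  using \<open>lo \<le> n\<close>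
proof (induction L arbitrary: a lo F)
  case Nil
  have "ordered_sum D n lo [a] (koszul_diff y F) = (\<Sum>k\<in>{lo<..n}. (y k * D k a) * F [])"
    by (simp add: koszul_diff_Cons algebra_simps)
  also have "\<dots> = (\<Sum>k\<in>{lo<..n}. T k a - T (Suc k) a) * F []"
    unfolding sum_distrib_right by (intro sum.cong) (auto simp: difference)
  finally show ?case
    using sum_telescope_above[OF Nil, of "\<lambda>k. T k a"]
    by (simp add: merge_sum_singleton algebra_simps)
next
  case (Cons b L)
  let ?S = "\<lambda>k. ordered_sum D n k L (\<lambda>K. F (k # K))"
  have "ordered_sum D n lo (a # b # L) (koszul_diff y F) =
      (\<Sum>k\<in>{lo<..n}. (y k * D k a) * ordered_sum D n k (b # L) F) -
      (\<Sum>k\<in>{lo<..n}. D k a * ordered_sum D n k (b # L) (koszul_diff y (\<lambda>K. F (k # K))))"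
    by (simp only: ordered_sum.simps(2)[of _ _ _ a] koszul_diff_Cons ordered_sum_diff ordered_sum_mult
        sum_subtractf[symmetric]) (simp only: algebra_simps)
  also have "(\<Sum>k\<in>{lo<..n}. (y k * D k a) * ordered_sum D n k (b # L) F) =
      (\<Sum>k\<in>{lo<..n}. \<Sum>k'\<in>{k<..n}. (T k a - T (Suc k) a) * (D k' b * ?S k'))"
    by (intro sum.cong) (auto simp: difference sum_distrib_left)
  also have "\<dots> = (\<Sum>k\<in>{lo<..n}. \<Sum>k' | k' \<in> {lo<..n} \<and> k < k'. (T k a - T (Suc k) a) * (D k' b * ?S k'))"
    by (intro sum.cong) auto
  also have "\<dots> = (\<Sum>k'\<in>{lo<..n}. \<Sum>k | k \<in> {lo<..n} \<and> k < k'. (T k a - T (Suc k) a) * (D k' b * ?S k'))"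
    by (rule sum.swap_restrict) simp_all
  also have "\<dots> = (\<Sum>k'\<in>{lo<..n}. \<Sum>k\<in>{lo<..k' - 1}. (T k a - T (Suc k) a) * (D k' b * ?S k'))"
    by (intro sum.cong) auto
  \<comment> \<open>For fixed \<open>k'\<close> the sum over \<open>k\<close> telescopes.\<close>
  also have "\<dots> = (\<Sum>k'\<in>{lo<..n}. (T (Suc lo) a - T k' a) * (D k' b * ?S k'))"
  proof (intro sum.cong refl)
    fix k' assume "k' \<in> {lo<..n}"
    hence "lo \<le> k' - 1" "Suc (k' - 1) = k'"
      by auto
    thus "(\<Sum>k\<in>{lo<..k' - 1}. (T k a - T (Suc k) a) * (D k' b * ?S k')) =
        (T (Suc lo) a - T k' a) * (D k' b * ?S k')"
      using sum_telescope_above[of lo "k' - 1" "\<lambda>k. T k a"]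
      by (simp flip: sum_distrib_right)
  qed
  also have "(\<Sum>k\<in>{lo<..n}. D k a * ordered_sum D n k (b # L) (koszul_diff y (\<lambda>K. F (k # K)))) =
      (\<Sum>k\<in>{lo<..n}. D k a * (T (Suc k) b * ?S k - merge_sum D (T (Suc n)) n k (b # L) (\<lambda>K. F (k # K))))"
    by (intro sum.cong refl) (simp add: Cons.IH del: ordered_sum.simps)
  also have "(\<Sum>k'\<in>{lo<..n}. (T (Suc lo) a - T k' a) * (D k' b * ?S k')) - \<dots> =
      (\<Sum>k\<in>{lo<..n}. T (Suc lo) a * (D k b * ?S k)) -
      ((\<Sum>k\<in>{lo<..n}. (D k a * T (Suc k) b + T k a * D k b) * ?S k) -
       (\<Sum>k\<in>{lo<..n}. D k a * merge_sum D (T (Suc n)) n k (b # L) (\<lambda>K. F (k # K))))"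
    by (simp add: sum_subtractf[symmetric] sum.distrib[symmetric] algebra_simps)
  also have "(\<Sum>k\<in>{lo<..n}. (D k a * T (Suc k) b + T k a * D k b) * ?S k) =
      ordered_sum D n lo ((a + b) # L) F"
    unfolding ordered_sum.simps by (intro sum.cong refl) (auto simp: derivation)
  finally show ?case
    by (simp add: merge_sum_Cons_Cons sum_distrib_left)
qed

section \<open>Exponents and weights in the formula for \<open>\<Psi>\<close>\<close>

(* keeps the index set {1..n} and the exponent of a variable in the form in which they are stated *)
declare One_nat_def [simp del]

lemma single_sum: "Poly_Mapping.single k (sum f A) = (\<Sum>x\<in>A. Poly_Mapping.single k (f x))"
  by (induction A rule: infinite_finite_induct) (simp_all add: single_add)

lemma cscale_single [simp]: "cscale c (Poly_Mapping.single k f) = Poly_Mapping.single k (cst c * f)"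
  by (simp add: cscale_def)

lemma weight_one [simp]: "weight n (\<lambda>_. 1) m = 1"
  by (simp add: weight_def)

lemma weight_diff_single:
  "w i = 1 \<Longrightarrow> weight n w (m - Poly_Mapping.single i k) = weight n w m"
  unfolding weight_def by (intro prod.cong) (auto simp: lookup_minus lookup_single when_def)

lemma prod_cst_xvar_power:
  assumes "m \<in> mons n"
  shows "(\<Prod>i\<in>Poly_Mapping.keys m. (cst (w i) * xvar i) ^ Poly_Mapping.lookup m i) =
    cst (weight n w m) * xmon m"
proof -
  have "(\<Prod>i\<in>Poly_Mapping.keys m. w i ^ Poly_Mapping.lookup m i) = weight n w m"
    unfolding weight_def using assms
    by (intro prod.mono_neutral_left) (auto simp: mons_def in_keys_iff)
  moreover have "(\<Prod>i\<in>Poly_Mapping.keys m. xvar i ^ Poly_Mapping.lookup m i) = xmon m"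
    by (simp only: xvar_power xmon_sum[symmetric] sum_single_lookup)
  ultimately show ?thesis
    by (simp add: power_mult_distrib prod.distrib cst_power[symmetric] cst_prod[symmetric])
qed

lemma prod_sum_PiE_lessThan:
  fixes u :: "nat \<Rightarrow> 'b \<Rightarrow> 'r::comm_semiring_1"
  shows "(\<Sum>a\<in>(\<Pi>\<^sub>E k\<in>{..<p}. B k). \<Prod>k<p. u k (a k)) = (\<Prod>k<p. \<Sum>b\<in>B k. u k b)"
proof (induction p)
  case 0
  show ?case by simp
next
  case (Suc p)
  have inj: "inj_on (\<lambda>(b, a). a(p := b)) (B p \<times> (\<Pi>\<^sub>E k\<in>{..<p}. B k))"
    by (rule inj_combinator) simp
  have "(\<Sum>a\<in>(\<Pi>\<^sub>E k\<in>{..<Suc p}. B k). \<Prod>k<Suc p. u k (a k)) =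
      (\<Sum>(b, a)\<in>B p \<times> (\<Pi>\<^sub>E k\<in>{..<p}. B k). \<Prod>k<Suc p. u k ((a(p := b)) k))"
    unfolding lessThan_Suc[of p] PiE_insert_eq sum.reindex[OF inj] by (simp add: split_def)
  also have "\<dots> = (\<Sum>b\<in>B p. \<Sum>a\<in>(\<Pi>\<^sub>E k\<in>{..<p}. B k). (\<Prod>k<p. u k (a k)) * u p b)"
    by (simp add: sum.cartesian_product split_def)
  also have "\<dots> = (\<Prod>k<Suc p. \<Sum>b\<in>B k. u k b)"
    by (simp add: Suc.IH flip: sum_distrib_right sum_distrib_left)
  finally show ?case .
qed

lemma lookup_sum_list_nth:
  "Poly_Mapping.lookup (sum_list L) i = (\<Sum>k<length L. Poly_Mapping.lookup (L ! k) i)"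
  by (induction L) (simp_all add: lookup_add sum.lessThan_Suc_shift del: sum.lessThan_Suc)

lemma lookup_sum_singles:
  assumes "finite A"
  shows "Poly_Mapping.lookup (\<Sum>i\<in>A. Poly_Mapping.single i (h i)) j = (if j \<in> A then h j else 0)"
  using assms by (simp add: lookup_sum lookup_single when_def sum.delta')

text \<open>
  As a sum over tensor positions, \<open>Q\<close> can be compared with the other exponents position by position.
\<close>

lemma lookup_Qexp:
  assumes "i \<in> {1..n}"
  shows "Poly_Mapping.lookup (Qexp n p L I a) i =
    (\<Sum>k<p. if I ! k = i then a k else if I ! k < i then Poly_Mapping.lookup (L ! k) i else 0)"
proof -
  have filter: "sum h {k. k < p \<and> P k} = (\<Sum>k<p. if P k then h k else 0)" for h :: "nat \<Rightarrow> nat" and P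
    using sum.inter_filter[of "{..<p}" h P] by simp
  show ?thesis
    using assms unfolding Qexp_def lookup_sum_singles[OF finite_atLeastAtMost] filter sum.distrib[symmetric]
    by (simp only: if_True) (intro sum.cong, auto)
qed

text \<open>
  In the position \<open>k\<close> with index \<open>i\<^sub>k\<close>, the exponent \<open>\<ell>\<^sup>k\<close> is divided as follows: its components above
  \<open>i\<^sub>k\<close> go to \<open>Q\<close>, those below \<open>i\<^sub>k\<close> go to the complementary exponent, and the component at \<open>i\<^sub>k\<close> is
  \<open>a\<^sub>k\<close> (in \<open>Q\<close>) plus \<open>1\<close> (for the exterior factor) plus the rest (in the complementary exponent).
\<close>

lemma Qexp_Qhat:
  assumes L: "length L = p" "set L \<subseteq> mons n" and I: "I \<in> inc n p"
    and a: "\<And>k. k < p \<Longrightarrow> a k < Poly_Mapping.lookup (L ! k) (I ! k)"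
  shows "Qexp n p L I a + Qhat n p L I a = (\<Sum>k<p. L ! k - Poly_Mapping.single (I ! k) 1)" (is ?sum)
    and "i \<in> {1..n} \<Longrightarrow> Poly_Mapping.lookup (Qhat n p L I a) i =
      (\<Sum>k<p. if i < I ! k then Poly_Mapping.lookup (L ! k) i
              else if i = I ! k then Poly_Mapping.lookup (L ! k) i - 1 - a k else 0)" (is "_ \<Longrightarrow> ?hat i")
proof -
  let ?Q = "Qexp n p L I a"
  let ?E = "sum_list (map (\<lambda>i. Poly_Mapping.single i 1) I) :: mon"
  let ?h = "\<lambda>i k. if i < I ! k then Poly_Mapping.lookup (L ! k) i
              else if i = I ! k then Poly_Mapping.lookup (L ! k) i - 1 - a k else 0"
  have len: "length I = p"
    using I by (simp add: inc_def)
  have E: "Poly_Mapping.lookup ?E i = (\<Sum>k<p. if I ! k = i then 1 else 0)" for i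
    using len unfolding lookup_sum_list_nth
    by (intro sum.cong) (auto simp: lookup_single when_def)
  \<comment> \<open>The hypothesis on \<open>a\<close> makes all subtractions of natural numbers genuine.\<close>
  have total: "Poly_Mapping.lookup (sum_list L) i =
      Poly_Mapping.lookup ?Q i + Poly_Mapping.lookup ?E i + (\<Sum>k<p. ?h i k)" if "i \<in> {1..n}" for i
    unfolding lookup_Qexp[OF that] E
    unfolding lookup_sum_list_nth L(1) sum.distrib[symmetric]
    by (intro sum.cong refl) (auto dest!: a)
  have hat: "?hat i" if "i \<in> {1..n}" for i
    by (simp add: Qhat_def lookup_minus lookup_add total[OF that])
  show "i \<in> {1..n} \<Longrightarrow> ?hat i"
    by (rule hat)
  have outside: "Poly_Mapping.lookup m i = 0" if "m \<in> mons n" "i \<notin> {1..n}" for m i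
    using that by (auto simp: mons_def in_keys_iff)
  have nth: "L ! k \<in> mons n" if "k < p" for k
    using L that by auto
  show ?sum
  proof (rule poly_mapping_eqI)
    fix i
    show "Poly_Mapping.lookup (?Q + Qhat n p L I a) i =
        Poly_Mapping.lookup (\<Sum>k<p. L ! k - Poly_Mapping.single (I ! k) 1) i"
    proof (cases "i \<in> {1..n}")
      case True
      show ?thesis
        unfolding lookup_add hat[OF True] lookup_Qexp[OF True] lookup_sum sum.distrib[symmetric] lookup_minus
        by (intro sum.cong refl) (auto simp: lookup_single when_def dest!: a)
    next
      case False
      have "sum_list L \<in> mons n"
        using L by (simp add: mons_sum_list)
      moreover have "?Q \<in> mons n"
        by (auto simp: mons_def in_keys_iff Qexp_def lookup_sum_singles split: if_splits)
      ultimately show ?thesis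
        using False nth
        by (simp add: lookup_add lookup_sum lookup_minus Qhat_def outside)
    qed
  qed
qed

text \<open>
  By \<open>Qexp_Qhat\<close> the complementary exponent takes from position \<open>k\<close> the components below \<open>i\<^sub>k\<close>, whose
  weight is that of \<open>s\<^sub>1 \<dots> s\<^bsub>i - 1\<^esub>\<close> with \<open>i = i\<^sub>k\<close>, and a power of \<open>v\<^bsub>i\<^esub>\<close>.
\<close>

lemma weight_Qhat:
  assumes L: "length L = p" "set L \<subseteq> mons n" and I: "I \<in> inc n p"
    and a: "\<And>k. k < p \<Longrightarrow> a k < Poly_Mapping.lookup (L ! k) (I ! k)"
  shows "weight n w (Qhat n p L I a) =
    (\<Prod>k<p. weight n (refl_weights w (I ! k)) (L ! k) * w (I ! k) ^ (Poly_Mapping.lookup (L ! k) (I ! k) - 1 - a k))"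
proof -
  let ?h = "\<lambda>k i. if i < I ! k then Poly_Mapping.lookup (L ! k) i
              else if i = I ! k then Poly_Mapping.lookup (L ! k) i - 1 - a k else 0"
  have factor: "(\<Prod>i\<in>{1..n}. w i ^ ?h k i) =
      weight n (refl_weights w (I ! k)) (L ! k) * w (I ! k) ^ (Poly_Mapping.lookup (L ! k) (I ! k) - 1 - a k)"
    if "k < p" for k
  proof -
    have "I ! k \<in> {1..n}"
      using that I nth_mem[of k I] by (auto simp: inc_def simp del: nth_mem)
    moreover have "(\<Prod>i\<in>{1..n}. w i ^ ?h k i) = (\<Prod>i\<in>{1..n}. refl_weights w (I ! k) i ^ Poly_Mapping.lookup (L ! k) i *
        (if i = I ! k then w (I ! k) ^ (Poly_Mapping.lookup (L ! k) (I ! k) - 1 - a k) else 1))"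
      by (intro prod.cong refl) (auto simp: refl_weights_def)
    ultimately show ?thesis
      by (simp add: prod.distrib weight_def)
  qed
  have "weight n w (Qhat n p L I a) = (\<Prod>i\<in>{1..n}. \<Prod>k<p. w i ^ ?h k i)"
    unfolding weight_def by (intro prod.cong refl) (simp only: Qexp_Qhat(2)[OF assms] power_sum)
  also have "\<dots> = (\<Prod>k<p. \<Prod>i\<in>{1..n}. w i ^ ?h k i)"
    by (rule prod.swap)
  finally show ?thesis
    using factor by simp
qed

section \<open>The action on the symmetric algebra in an eigenbasis\<close>

locale eigenbasis =
  fixes G :: "('g, 'm) monoid_scheme"
    and scale :: "complex \<Rightarrow> 'v::ab_group_add \<Rightarrow> 'v"
    and \<rho> :: "'g \<Rightarrow> 'v \<Rightarrow> 'v"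
    and g :: 'g
    and n :: nat
    and v :: "nat \<Rightarrow> 'v"
    and \<epsilon> :: "nat \<Rightarrow> complex"
  assumes group: "Group.group G"
    and cg: "cg_module G scale \<rho>"
    and g_carrier: "g \<in> carrier G"
    and basis: "is_basis scale n v"
    and eigen: "\<forall>i\<in>{1..n}. \<rho> g (v i) = scale (\<epsilon> i) (v i)"
begin

abbreviation "act \<equiv> gact scale n v \<rho>"

lemma vs: "vector_space scale"
  using cg by (simp add: cg_module_def)

lemma scale_1: "scale 1 w = w"
proof -
  interpret vector_space scale by (rule vs)
  show ?thesis by simp
qed

lemma coord_scaled_basis:
  assumes "i \<in> {1..n}" "j \<in> {1..n}"
  shows "coord scale n v (scale c (v i)) j = (if j = i then c else 0)"
proof -
  interpret vector_space scale by (rule vs)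
  have indep: "independent (v ` {1..n})" and inj: "inj_on v {1..n}"
    using basis by (simp_all add: is_basis_def)
  have "v i \<in> v ` {1..n}"
    using assms by blast
  moreover have "v j = v i \<longleftrightarrow> j = i"
    using inj assms by (auto dest: inj_onD)
  ultimately show ?thesis
    by (simp add: coord_def representation_scale[OF indep span_base] representation_basis[OF indep])
qed

lemma emb_scaled_basis:
  assumes "i \<in> {1..n}"
  shows "emb scale n v (scale c (v i)) = cst c * xvar i"
proof -
  have "emb scale n v (scale c (v i)) = (\<Sum>j\<in>{1..n}. if j = i then cst c * xvar j else 0)"
    unfolding emb_def by (intro sum.cong refl) (simp add: coord_scaled_basis[OF assms])
  thus ?thesis using assms by simp
qed

text \<open>
  The endomorphisms of \<open>S(V)\<close> induced by \<open>g\<close>, by the unit of the group, by the \<open>s\<^sub>i\<close> and by their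
  products are all of this kind, so they act on monomials by weights.  The restriction to \<open>S(V)\<close> matters: a variable with an index outside \<open>1, \<dots>, n\<close> stands for no
  basis vector.
\<close>

lemma symext_diagonal:
  assumes "\<And>i. i \<in> {1..n} \<Longrightarrow> T (v i) = scale (w i) (v i)" and "f \<in> SV n"
  shows "symext scale n v T f = lin_ext (\<lambda>m. cst (weight n w m) * xmon m) f"
proof -
  have "(\<Prod>i\<in>Poly_Mapping.keys m. emb scale n v (T (v i)) ^ Poly_Mapping.lookup m i) =
      cst (weight n w m) * xmon m" if "m \<in> Poly_Mapping.keys f" for m
  proof -
    have m: "m \<in> mons n"
      using that assms(2) by (rule keys_SV[rotated])
    hence "(\<Prod>i\<in>Poly_Mapping.keys m. emb scale n v (T (v i)) ^ Poly_Mapping.lookup m i) =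
        (\<Prod>i\<in>Poly_Mapping.keys m. (cst (w i) * xvar i) ^ Poly_Mapping.lookup m i)"
      by (intro prod.cong refl) (auto simp: mons_def assms(1) emb_scaled_basis)
    thus ?thesis by (simp add: prod_cst_xvar_power[OF m])
  qed
  thus ?thesis
    by (simp add: symext_def lin_ext_def)
qed

lemma refl_map_basis:
  assumes "j \<in> {1..n}"
  shows "refl_map scale n v \<epsilon> i (scale c (v j)) = scale ((if j = i then \<epsilon> j else 1) * c) (v j)"
proof -
  interpret vector_space scale by (rule vs)
  have "refl_map scale n v \<epsilon> i (scale c (v j)) =
      (\<Sum>k\<in>{1..n}. if k = j then scale ((if j = i then \<epsilon> j else 1) * c) (v j) else 0)"
    unfolding refl_map_def by (intro sum.cong refl) (auto simp: coord_scaled_basis[OF assms])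
  thus ?thesis using assms by simp
qed

lemma refl_prod_basis:
  assumes "i \<in> {1..n}"
  shows "refl_prod scale n v \<epsilon> j (v i) = scale (refl_weights \<epsilon> j i) (v i)"
proof -
  have "foldr (\<lambda>i T. refl_map scale n v \<epsilon> i \<circ> T) is id (v i) =
      scale (if i \<in> set is then \<epsilon> i else 1) (v i)" if "distinct is" for "is"
    using that
    by (induction "is") (auto simp: refl_map_basis[OF assms] scale_1)
  from this[of "[1..<j]"] show ?thesis
    using assms by (simp add: refl_prod_def refl_weights_def)
qed

lemma symext_refl_prod:
  "f \<in> SV n \<Longrightarrow> symext scale n v (refl_prod scale n v \<epsilon> j) f = lin_ext (twist n \<epsilon> j) f"
  using symext_diagonal[of "refl_prod scale n v \<epsilon> j" "refl_weights \<epsilon> j"] refl_prod_basis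
  by (simp add: twist_def[abs_def])

lemma act_g: "f \<in> SV n \<Longrightarrow> act g f = lin_ext (twist n \<epsilon> (Suc n)) f"
  using symext_diagonal[of "\<rho> g" \<epsilon>] eigen
  by (simp add: gact_def twist_def[abs_def])

lemma act_one:
  assumes "f \<in> SV n"
  shows "act \<one>\<^bsub>G\<^esub> f = f"
proof -
  have "\<rho> \<one>\<^bsub>G\<^esub> (v i) = scale 1 (v i)" for i
    using cg by (simp add: cg_module_def scale_1)
  thus ?thesis
    using symext_diagonal[of "\<rho> \<one>\<^bsub>G\<^esub>" "\<lambda>_. 1" f] assms by (simp add: gact_def lin_ext_xmon_id)
qed

lemma act_zero: "act h 0 = 0"
  by (simp add: gact_def symext_def)

text \<open>
  For \<open>\<epsilon>\<^sub>i \<noteq> 1\<close> the right hand side satisfies the equation that defines the quotient, and the polynomial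
  ring has no zero divisors.
\<close>

lemma qderiv_eq:
  assumes i: "i \<in> {1..n}" and f: "f \<in> SV n"
  shows "qderiv scale n v \<epsilon> i f =
    lin_ext (\<lambda>m. cst (qnum (\<epsilon> i) (Poly_Mapping.lookup m i)) * xmon (m - Poly_Mapping.single i 1)) f"
    (is "_ = ?q")
proof (cases "\<epsilon> i = 1")
  case True
  thus ?thesis
    by (simp add: qderiv_def partial_deriv_def lin_ext_def qnum_eq_1 cst_mult ac_simps
        flip: cst_mult_xmon)
next
  case False
  let ?w = "\<lambda>j. if j = i then \<epsilon> j else 1"
  let ?d = "emb scale n v (v i) - emb scale n v (refl_map scale n v \<epsilon> i (v i))"
  let ?r = "f - symext scale n v (refl_map scale n v \<epsilon> i) f"
  have refl: "refl_map scale n v \<epsilon> i (v j) = scale (?w j) (v j)" if "j \<in> {1..n}" for j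
    using refl_map_basis[OF that, of i 1] by (simp add: scale_1)
  have d: "?d = cst (1 - \<epsilon> i) * xvar i"
    using emb_scaled_basis[OF i, of 1] emb_scaled_basis[OF i, of "\<epsilon> i"] refl[OF i]
    by (simp add: scale_1 cst_diff algebra_simps)
  have d_nz: "?d \<noteq> 0"
    unfolding d xvar_def cst_mult_xmon using False
    by (metis lookup_single_eq lookup_zero right_minus_eq)
  have w: "weight n ?w m = \<epsilon> i ^ Poly_Mapping.lookup m i" for m
    using i by (simp add: weight_def if_distrib[of "\<lambda>x. x ^ _"] prod.delta cong: if_cong)
  have "xmon m - cst (\<epsilon> i ^ Poly_Mapping.lookup m i) * xmon m =
      cst (qnum (\<epsilon> i) (Poly_Mapping.lookup m i)) * xmon (m - Poly_Mapping.single i 1) * ?d" for m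
  proof -
    let ?k = "Poly_Mapping.lookup m i"
    have *: "cst (qnum (\<epsilon> i) ?k) * (xmon (m - Poly_Mapping.single i 1) * xvar i) =
        cst (qnum (\<epsilon> i) ?k) * xmon m"
      by (cases "?k = 0") (simp_all add: xvar_def diff_single_add[of m i] del: One_nat_def flip: xmon_add)
    have "cst (qnum (\<epsilon> i) ?k) * xmon (m - Poly_Mapping.single i 1) * ?d =
        cst (1 - \<epsilon> i) * (cst (qnum (\<epsilon> i) ?k) * (xmon (m - Poly_Mapping.single i 1) * xvar i))"
      unfolding d by (simp only: ac_simps)
    also have "\<dots> = cst ((1 - \<epsilon> i) * qnum (\<epsilon> i) ?k) * xmon m"
      unfolding * by (simp only: cst_mult ac_simps)
    also have "\<dots> = xmon m - cst (\<epsilon> i ^ ?k) * xmon m"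
      unfolding qnum_mult by (simp add: cst_diff left_diff_distrib)
    finally show ?thesis ..
  qed
  hence "?q * ?d = lin_ext xmon f - lin_ext (\<lambda>m. cst (weight n ?w m) * xmon m) f"
    by (simp only: lin_ext_mult_right[symmetric] lin_ext_diff_fun[symmetric] w)
  also have "\<dots> = ?r"
    using symext_diagonal[OF refl f] by (simp add: lin_ext_xmon_id)
  finally have q: "?q * ?d = ?r" .
  have "(THE q. q * ?d = ?r) = ?q"
  proof (rule the_equality[where P = "\<lambda>q. q * ?d = ?r", OF q])
    fix q assume "q * ?d = ?r"
    with q have "q * ?d = ?q * ?d"
      by (simp only:)
    thus "q = ?q"
      by (rule mult_right_cancel[OF d_nz, THEN iffD1])
  qed
  thus ?thesis
    using False by (simp add: qderiv_def)
qed

lemma symext_qderiv: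
  assumes j: "j \<in> {1..n}" and f: "f \<in> SV n"
  shows "symext scale n v (refl_prod scale n v \<epsilon> j) (qderiv scale n v \<epsilon> j f) = lin_ext (twisted_deriv n \<epsilon> j) f"
proof -
  let ?q = "\<lambda>m. cst (qnum (\<epsilon> j) (Poly_Mapping.lookup m j)) * xmon (m - Poly_Mapping.single j 1)"
  have "lin_ext ?q f \<in> SV n"
    using f by (intro SV_lin_ext SV_mult SV_cst SV_xmon mons_diff) (auto dest: keys_SV)
  moreover have "refl_weights \<epsilon> j j = 1"
    by (simp add: refl_weights_def)
  ultimately show ?thesis
    by (simp add: qderiv_eq[OF assms] symext_refl_prod lin_ext_lin_ext lin_ext_cst_mult)
      (simp add: twist_def twisted_deriv_def[abs_def] weight_diff_single cst_mult ac_simps)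
qed

section \<open>Cochains with values in one component of the skew group algebra\<close>

text \<open>
  The bimodule structure of \<open>S(V) g\<close> in terms of the polynomial coefficient: left multiplication is
  multiplication, right multiplication is multiplication after applying \<open>g\<close>.
\<close>

lemma skew_mult_incl_single:
  "f \<in> SV n \<Longrightarrow>
    skew_mult G act (incl G a) (Poly_Mapping.single g f) = Poly_Mapping.single g (a * f)"
  using group g_carrier
  by (cases "a = 0"; cases "f = 0") (simp_all add: skew_mult_def incl_def act_one Group.group.is_monoid)

lemma skew_mult_single_incl:
  "skew_mult G act (Poly_Mapping.single g f) (incl G b) = Poly_Mapping.single g (f * act g b)"
  using group g_carrier
  by (cases "b = 0"; cases "f = 0") (simp_all add: skew_mult_def incl_def act_zero Group.group.is_monoid)

text \<open>
  The coefficient of \<open>v\<^sup>a \<cdot> f g \<cdot> v\<^sup>b\<close>.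
\<close>

definition sandwich :: "spoly \<Rightarrow> mon \<times> mon \<Rightarrow> spoly" where
  "sandwich f = (\<lambda>(a, b). xmon a * f * act g (xmon b))"

lemma env_act_single:
  assumes "f \<in> SV n"
  shows "env_act G act x (Poly_Mapping.single g f) = Poly_Mapping.single g (lin_ext (sandwich f) x)"
  using assms
  by (simp add: env_act_def lin_ext_def single_sum skew_mult_incl_single skew_mult_single_incl
      sandwich_def split_def)

text \<open>
  The polynomial coefficient of \<open>kos_hom\<close>, for a cochain with coefficients \<open>F\<close>.
\<close>

definition kos_eval :: "(nat list \<Rightarrow> spoly) \<Rightarrow> kosz \<Rightarrow> spoly" where
  "kos_eval F \<kappa> = (\<Sum>J\<in>Poly_Mapping.keys \<kappa>. lin_ext (sandwich (F J)) (Poly_Mapping.lookup \<kappa> J))"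

lemma kos_eval_add: "kos_eval F (\<kappa> + \<kappa>') = kos_eval F \<kappa> + kos_eval F \<kappa>'"
  unfolding kos_eval_def by (rule setsum_keys_plus_distrib) (simp_all add: lin_ext_add)

lemma kos_eval_sum: "kos_eval F (sum f A) = (\<Sum>x\<in>A. kos_eval F (f x))"
  by (induction A rule: infinite_finite_induct) (simp_all add: kos_eval_add, simp_all add: kos_eval_def)

lemma kos_eval_single: "kos_eval F (Poly_Mapping.single J x) = lin_ext (sandwich (F J)) x"
  by (simp add: kos_eval_def)

definition coeff :: "'g kcochain \<Rightarrow> nat list \<Rightarrow> spoly" where
  "coeff \<alpha> J = Poly_Mapping.lookup (Poly_Mapping.lookup \<alpha> J) g"

lemma kcochain_coeff:
  assumes "\<alpha> \<in> kcochains n g p"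
  shows "Poly_Mapping.lookup \<alpha> J = Poly_Mapping.single g (coeff \<alpha> J)" "coeff \<alpha> J \<in> SV n"
proof -
  have "Poly_Mapping.lookup \<alpha> J \<in> Sbar n g"
    using assms by (simp add: kcochains_def)
  thus "Poly_Mapping.lookup \<alpha> J = Poly_Mapping.single g (coeff \<alpha> J)" "coeff \<alpha> J \<in> SV n"
    by (auto simp: Sbar_def coeff_def)
qed

lemma kos_hom_eq:
  assumes "\<alpha> \<in> kcochains n g p"
  shows "kos_hom G act \<alpha> \<kappa> = Poly_Mapping.single g (kos_eval (coeff \<alpha>) \<kappa>)"
  by (simp add: kos_hom_def kos_eval_def kcochain_coeff[OF assms] env_act_single single_sum)

section \<open>The two maps on monomials\<close>

lemma act_xmon: "m \<in> mons n \<Longrightarrow> act g (xmon m) = cst (weight n \<epsilon> m) * xmon m"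
  by (simp add: act_g SV_xmon twist_def)

text \<open>
  The heart of the equality of the two maps: the weights of the complementary exponents are products
  over positions, so that the sum over all \<open>a\<close> is a product of geometric sums.
\<close>

lemma sum_sandwich_Q:
  assumes L: "length L = p" "set L \<subseteq> mons n" and I: "I \<in> inc n p"
  shows "(\<Sum>a\<in>(\<Pi>\<^sub>E k\<in>{..<p}. {..<Poly_Mapping.lookup (L ! k) (I ! k)}).
      sandwich f (Qexp n p L I a, Qhat n p L I a)) =
    (\<Prod>k<p. twisted_deriv n \<epsilon> (I ! k) (L ! k)) * f" (is "sum ?s ?P = _")
proof -
  let ?l = "\<lambda>k. Poly_Mapping.lookup (L ! k) (I ! k)"
  let ?W = "\<lambda>k. weight n (refl_weights \<epsilon> (I ! k)) (L ! k)"
  let ?x = "xmon (\<Sum>k<p. L ! k - Poly_Mapping.single (I ! k) 1)"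
  have "sum ?s ?P = (\<Sum>a\<in>?P. cst (\<Prod>k<p. ?W k * \<epsilon> (I ! k) ^ (?l k - Suc (a k))) * (?x * f))"
  proof (intro sum.cong refl)
    fix a assume "a \<in> ?P"
    hence a: "a k < ?l k" if "k < p" for k
      using that by (auto simp: PiE_iff)
    have "Qhat n p L I a \<in> mons n"
      unfolding Qhat_def using L by (intro mons_diff mons_sum_list)
    hence "?s a = cst (weight n \<epsilon> (Qhat n p L I a)) * (xmon (Qexp n p L I a + Qhat n p L I a) * f)"
      by (simp add: sandwich_def act_xmon xmon_add ac_simps)
    thus "?s a = cst (\<Prod>k<p. ?W k * \<epsilon> (I ! k) ^ (?l k - Suc (a k))) * (?x * f)"
      by (simp only: Qexp_Qhat(1)[OF assms a] weight_Qhat[OF assms a] diff_diff_left plus_1_eq_Suc)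
  qed
  also have "\<dots> = cst (\<Prod>k<p. \<Sum>b<?l k. ?W k * \<epsilon> (I ! k) ^ (?l k - Suc b)) * (?x * f)"
    by (simp only: sum_distrib_right[symmetric] cst_sum[symmetric]
        prod_sum_PiE_lessThan[of "\<lambda>k b. ?W k * \<epsilon> (I ! k) ^ (?l k - Suc b)"])
  \<comment> \<open>The substitution of \<open>\<ell> - 1 - b\<close> for \<open>b\<close> puts the geometric sum into the form of a \<open>q\<close>-integer.\<close>
  also have "(\<Prod>k<p. \<Sum>b<?l k. ?W k * \<epsilon> (I ! k) ^ (?l k - Suc b)) =
      (\<Prod>k<p. ?W k * qnum (\<epsilon> (I ! k)) (?l k))"
    by (simp only: sum_distrib_left[symmetric] sum.nat_diff_reindex qnum_def)
  also have "cst \<dots> * (?x * f) = (\<Prod>k<p. twisted_deriv n \<epsilon> (I ! k) (L ! k)) * f"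
    by (simp only: twisted_deriv_def cst_mult prod.distrib cst_prod xmon_sum mult.assoc)
  finally show ?thesis .
qed

lemma finite_inc: "finite (inc n p)"
  by (rule finite_subset[OF _ finite_lists_length_eq[of "{1..n}" p]]) (auto simp: inc_def)

lemma kos_eval_psi:
  "kos_eval F (psi n p t) = lin_ext (\<lambda>ms. \<Sum>I\<in>inc n p.
      \<Sum>a\<in>(\<Pi>\<^sub>E k\<in>{..<p}. {..<Poly_Mapping.lookup (butlast (tl ms) ! k) (I ! k)}).
        sandwich (F I) (hd ms + Qexp n p (butlast (tl ms)) I a, last ms + Qhat n p (butlast (tl ms)) I a)) t"
  unfolding psi_def Let_def kos_eval_sum kos_eval_single
  by (simp add: lin_ext_def[of _ t] sum_distrib_left mult_single lin_ext_sum)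

text \<open>
  The pullback along \<open>\<Psi>\<close> and, in \<open>upsilon_eq\<close>, the map \<open>\<Upsilon>\<close> have the same normal form, an ordered sum
  of twisted derivations extended linearly from lists of monomials.  The equality of the two maps is
  read off from it, and so is the compatibility with the differentials.
\<close>

lemma psi_star_eq:
  assumes \<alpha>: "\<alpha> \<in> kcochains n g p" and fs: "fs \<in> SVlists n p"
  shows "psi_star G act n p \<alpha> fs =
    Poly_Mapping.single g (lin_ext (\<lambda>L. ordered_sum (twisted_deriv n \<epsilon>) n 0 L (coeff \<alpha>)) (ptens fs))"
  unfolding psi_star_def kos_hom_eq[OF \<alpha>] kos_eval_psi lin_ext_ptens_units
proof (intro arg_cong[where f = "Poly_Mapping.single g"] lin_ext_cong)
  fix L assume "L \<in> Poly_Mapping.keys (ptens fs)"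
  from keys_ptens_SV[OF fs this]
  show "(\<Sum>I\<in>inc n p. \<Sum>a\<in>(\<Pi>\<^sub>E k\<in>{..<p}. {..<Poly_Mapping.lookup (butlast (tl (0 # L @ [0])) ! k) (I ! k)}).
        sandwich (coeff \<alpha> I) (hd (0 # L @ [0]) + Qexp n p (butlast (tl (0 # L @ [0]))) I a,
          last (0 # L @ [0]) + Qhat n p (butlast (tl (0 # L @ [0]))) I a)) =
      ordered_sum (twisted_deriv n \<epsilon>) n 0 L (coeff \<alpha>)"
    by (simp add: sum_sandwich_Q ordered_sum_eq_sum)
qed

lemma upsilon_eq_sum:
  assumes \<alpha>: "\<alpha> \<in> kcochains n g p" and fs: "fs \<in> SVlists n p"
  shows "upsilon G act scale n v \<epsilon> p \<alpha> fs = Poly_Mapping.single g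
    (\<Sum>J\<in>inc n p. (\<Prod>k<p. lin_ext (twisted_deriv n \<epsilon> (J ! k)) (fs ! k)) * coeff \<alpha> J)"
proof -
  have "upsilon G act scale n v \<epsilon> p \<alpha> fs = Poly_Mapping.single g
      (\<Sum>J\<in>Poly_Mapping.keys \<alpha>. (\<Prod>k<p. symext scale n v (refl_prod scale n v \<epsilon> (J ! k))
          (qderiv scale n v \<epsilon> (J ! k) (fs ! k))) * coeff \<alpha> J)"
    by (simp add: upsilon_def kcochain_coeff[OF \<alpha>] skew_mult_incl_single single_sum)
  also have "(\<Sum>J\<in>Poly_Mapping.keys \<alpha>. (\<Prod>k<p. symext scale n v (refl_prod scale n v \<epsilon> (J ! k))
          (qderiv scale n v \<epsilon> (J ! k) (fs ! k))) * coeff \<alpha> J) =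
      (\<Sum>J\<in>Poly_Mapping.keys \<alpha>. (\<Prod>k<p. lin_ext (twisted_deriv n \<epsilon> (J ! k)) (fs ! k)) * coeff \<alpha> J)"
  proof (intro sum.cong refl arg_cong2[where f = "(*)"] prod.cong)
    fix J k assume "J \<in> Poly_Mapping.keys \<alpha>" "k \<in> {..<p}"
    hence "J ! k \<in> {1..n}" "fs ! k \<in> SV n"
      using \<alpha> fs by (auto simp: kcochains_def SVlists_def inc_def subset_iff)
    thus "symext scale n v (refl_prod scale n v \<epsilon> (J ! k)) (qderiv scale n v \<epsilon> (J ! k) (fs ! k)) =
        lin_ext (twisted_deriv n \<epsilon> (J ! k)) (fs ! k)"
      by (rule symext_qderiv)
  qed
  also have "\<dots> = (\<Sum>J\<in>inc n p. (\<Prod>k<p. lin_ext (twisted_deriv n \<epsilon> (J ! k)) (fs ! k)) * coeff \<alpha> J)"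
    using \<alpha> by (intro sum.mono_neutral_left finite_inc) (auto simp: kcochains_def coeff_def in_keys_iff)
  finally show ?thesis .
qed

lemma upsilon_eq:
  assumes \<alpha>: "\<alpha> \<in> kcochains n g p" and fs: "fs \<in> SVlists n p"
  shows "upsilon G act scale n v \<epsilon> p \<alpha> fs =
    Poly_Mapping.single g (lin_ext (\<lambda>L. ordered_sum (twisted_deriv n \<epsilon>) n 0 L (coeff \<alpha>)) (ptens fs))"
proof -
  have len: "length fs = p"
    using fs by (simp add: SVlists_def)
  have "lin_ext (\<lambda>L. ordered_sum (twisted_deriv n \<epsilon>) n 0 L (coeff \<alpha>)) (ptens fs) =
      lin_ext (\<lambda>L. \<Sum>J\<in>inc n p. (\<Prod>k<length fs. twisted_deriv n \<epsilon> (J ! k) (L ! k)) * coeff \<alpha> J) (ptens fs)"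
    by (intro lin_ext_cong) (simp add: ordered_sum_eq_sum keys_ptens_SV(1)[OF fs] len)
  thus ?thesis
    by (simp add: upsilon_eq_sum[OF assms] lin_ext_sum_fun lin_ext_mult_right len
        lin_ext_ptens_prod[of "\<lambda>k. twisted_deriv n \<epsilon> (J ! k)" fs for J, unfolded len])
qed

end

section \<open>The differentials\<close>

lemma lin_ext_bar_d:
  "lin_ext \<Phi> (bar_d p t) = lin_ext (\<lambda>ms. \<Sum>j\<le>p. (-1) ^ j * \<Phi> (merge_at j ms)) t"
  by (simp add: bar_d_def merge_at_def lin_ext_sum cst_mult cst_minus_one_power lin_ext_def[of _ t]
      sum_distrib_left ac_simps)

lemma keys_bar_d:
  assumes "ms \<in> Poly_Mapping.keys (bar_d p t)"
  obtains j ms' where "j \<le> p" "ms' \<in> Poly_Mapping.keys t" "ms = merge_at j ms'"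
proof -
  have "Poly_Mapping.keys (bar_d p t) \<subseteq> (\<Union>ms'\<in>Poly_Mapping.keys t. \<Union>j\<in>{..p}. {merge_at j ms'})"
    unfolding bar_d_def merge_at_def
    by (intro order.trans[OF keys_sum] UN_mono order_refl) (auto split: if_splits)
  with assms that show ?thesis by auto
qed

lemma keys_ptens_units:
  assumes "ms \<in> Poly_Mapping.keys (ptens (1 # fs @ [1]))"
  obtains L where "ms = 0 # L @ [0]" "list_all2 (\<lambda>m f. m \<in> Poly_Mapping.keys f) L fs"
  using keys_ptens[OF assms] that
  by (auto simp: list_all2_Cons2 list_all2_append2)

text \<open>
  The terms of the bar differential of \<open>1 \<otimes> f\<^sub>1 \<otimes> \<dots> \<otimes> f\<^sub>p \<otimes> 1\<close>: the outer two move an argument into the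
  enveloping algebra, the others merge two arguments.
\<close>

lemma merge_at_units:
  fixes L :: "mon list"
  assumes "L \<noteq> []" "j \<le> length L"
  shows "merge_at j (0 # L @ [0]) =
    (if j = 0 then hd L # tl L @ [0]
     else if j = length L then 0 # butlast L @ [last L]
     else 0 # merge_at (j - 1) L @ [0])"
proof -
  consider "j = 0" | "j = length L" "j \<noteq> 0" | i where "j = Suc i" "Suc i < length L"
    using assms by (cases j) (auto simp: le_less)
  thus ?thesis
  proof cases
    case 1
    with assms show ?thesis
      by (cases L) (simp_all add: merge_at_def)
  next
    case 2
    with assms obtain K z where "L = K @ [z]"
      by (cases L rule: rev_cases) auto
    with 2 show ?thesis
      by (simp add: merge_at_def nth_append)
  next
    case 3
    thus ?thesis
      by (simp add: merge_at_def nth_append)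
  qed
qed

lemma SVlists_xmon: "length L = p \<Longrightarrow> set L \<subseteq> mons n \<Longrightarrow> map xmon L \<in> SVlists n p"
  by (auto simp: SVlists_def SV_xmon)

lemma lin_ext_ptens_xmon: "lin_ext \<Phi> (ptens (map xmon L)) = \<Phi> L"
proof (induction L arbitrary: \<Phi>)
  case Nil
  show ?case by simp
next
  case (Cons m L)
  show ?case unfolding list.map lin_ext_ptens_Cons by (simp add: Cons.IH)
qed

lemma SV_twisted_deriv: "m \<in> mons n \<Longrightarrow> twisted_deriv n \<epsilon> j m \<in> SV n"
  unfolding twisted_deriv_def by (intro SV_mult SV_cst SV_xmon mons_diff)

context eigenbasis
begin

lemma SV_upsilon_sum:
  assumes \<alpha>: "\<alpha> \<in> kcochains n g p" and fs: "fs \<in> SVlists n p"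
  shows "(\<Sum>J\<in>inc n p. (\<Prod>k<p. lin_ext (twisted_deriv n \<epsilon> (J ! k)) (fs ! k)) * coeff \<alpha> J) \<in> SV n"
  using fs
  by (intro SV_sum SV_mult SV_prod SV_lin_ext SV_twisted_deriv kcochain_coeff(2)[OF \<alpha>])
    (auto simp: SVlists_def intro: keys_SV[OF subsetD, OF _ nth_mem])

lemma SV_ordered_sum:
  assumes \<alpha>: "\<alpha> \<in> kcochains n g p" and L: "length L = p" "set L \<subseteq> mons n"
  shows "ordered_sum (twisted_deriv n \<epsilon>) n 0 L (coeff \<alpha>) \<in> SV n"
  unfolding ordered_sum_eq_sum
  using L by (intro SV_sum SV_mult SV_prod SV_twisted_deriv kcochain_coeff(2)[OF \<alpha>]) auto

lemma bar_hom_eq: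
  assumes "\<And>ms. ms \<in> Poly_Mapping.keys t \<Longrightarrow>
      \<phi> (map xmon (butlast (tl ms))) = Poly_Mapping.single g (P (butlast (tl ms))) \<and> P (butlast (tl ms)) \<in> SV n"
  shows "bar_hom G act \<phi> t =
    Poly_Mapping.single g (lin_ext (\<lambda>ms. sandwich (P (butlast (tl ms))) (hd ms, last ms)) t)"
  using assms
  by (simp add: bar_hom_def lin_ext_def[of _ t] single_sum env_act_single)

text \<open>
  The usual formula for the bar coboundary, for polynomial coefficients \<open>P\<close>.  Values on lists of
  monomials suffice, because the bar differential expands pure tensors into monomials.
\<close>

lemma bar_codiff_eq:
  assumes \<phi>: "\<And>L. length L = p \<Longrightarrow> set L \<subseteq> mons n \<Longrightarrow>
      \<phi> (map xmon L) = Poly_Mapping.single g (P L) \<and> P L \<in> SV n"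
    and fs: "fs \<in> SVlists n (Suc p)"
  shows "bar_codiff G act p \<phi> fs = Poly_Mapping.single g
    (lin_ext (\<lambda>L. xmon (hd L) * P (tl L) - (\<Sum>j<p. (-1) ^ j * P (merge_at j L)) -
       (-1) ^ p * P (butlast L) * act g (xmon (last L))) (ptens fs))"
proof -
  let ?t = "ptens (1 # fs @ [1])"
  have keys: "\<phi> (map xmon (butlast (tl ms))) = Poly_Mapping.single g (P (butlast (tl ms))) \<and> P (butlast (tl ms)) \<in> SV n"
    if ms: "ms \<in> Poly_Mapping.keys (bar_d (p + 1) ?t)" for ms
  proof -
    obtain j ms' where j: "j \<le> p + 1" and ms': "ms' \<in> Poly_Mapping.keys ?t" "ms = merge_at j ms'"
      using keys_bar_d[OF ms] .
    obtain L where L: "ms' = 0 # L @ [0]" "list_all2 (\<lambda>m f. m \<in> Poly_Mapping.keys f) L fs"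
      using keys_ptens_units[OF ms'(1)] .
    have len: "length L = Suc p" and mons: "set L \<subseteq> mons n"
      using L(2) fs
      by (fastforce simp: SVlists_def list_all2_conv_all_nth in_set_conv_nth SV_def)+
    have nth: "L ! k \<in> mons n" if "k < Suc p" for k
      using that len mons by auto
    have "set (butlast (tl ms)) \<subseteq> mons n \<and> length (butlast (tl ms)) = p"
      using len mons j nth unfolding ms'(2) L(1)
      by (subst merge_at_units)
        (auto simp: merge_at_def butlast_append dest: in_set_takeD in_set_dropD in_set_butlastD
          list.set_sel(2)[rotated] intro!: mons_add)
    thus ?thesis using \<phi> by blast
  qed
  have "lin_ext (\<lambda>ms. sandwich (P (butlast (tl ms))) (hd ms, last ms)) (bar_d (p + 1) ?t) =
      lin_ext (\<lambda>L. \<Sum>j\<le>p + 1. (-1) ^ j * (let ms = merge_at j (0 # L @ [0]) in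
        sandwich (P (butlast (tl ms))) (hd ms, last ms))) (ptens fs)"
    by (simp only: lin_ext_bar_d lin_ext_ptens_units Let_def)
  also have "\<dots> = lin_ext (\<lambda>L. xmon (hd L) * P (tl L) - (\<Sum>j<p. (-1) ^ j * P (merge_at j L)) -
       (-1) ^ p * P (butlast L) * act g (xmon (last L))) (ptens fs)"
  proof (rule lin_ext_cong)
    fix L assume "L \<in> Poly_Mapping.keys (ptens fs)"
    note L = keys_ptens_SV[OF fs this]
    hence ne: "L \<noteq> []" by auto
    let ?s = "\<lambda>j. let ms = merge_at j (0 # L @ [0]) in sandwich (P (butlast (tl ms))) (hd ms, last ms)"
    have act1: "act g 1 = 1"
      by (simp add: act_g lin_ext_one twist_def weight_def)
    have split: "(\<Sum>j\<le>p + 1. f j) = f 0 + (\<Sum>j<p. f (Suc j)) + f (Suc p)" for f :: "nat \<Rightarrow> spoly"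
      by (simp add: sum.atMost_shift flip: Suc_eq_plus1)
    have first: "?s 0 = xmon (hd L) * P (tl L)"
      using ne by (simp add: merge_at_units sandwich_def Let_def butlast_append act1)
    have last: "?s (Suc p) = P (butlast L) * act g (xmon (last L))"
      using ne L by (simp add: merge_at_units sandwich_def Let_def butlast_append)
    have middle: "?s (Suc j) = P (merge_at j L)" if "j < p" for j
      using ne L that by (simp add: merge_at_units sandwich_def Let_def butlast_append act1)
    have middle_sum: "(\<Sum>j<p. (-1) ^ Suc j * ?s (Suc j)) = (\<Sum>j<p. - ((-1) ^ j * P (merge_at j L)))"
    proof (intro sum.cong refl)
      fix j assume "j \<in> {..<p}"
      hence "?s (Suc j) = P (merge_at j L)"
        by (intro middle) simp
      thus "(-1) ^ Suc j * ?s (Suc j) = - ((-1) ^ j * P (merge_at j L))"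
        by (simp only: power_Suc mult_minus1 minus_mult_left)
    qed
    have "(\<Sum>j\<le>p + 1. (-1) ^ j * ?s j) = ?s 0 + (\<Sum>j<p. (-1) ^ Suc j * ?s (Suc j)) + (-1) ^ Suc p * ?s (Suc p)"
      using split[of "\<lambda>j. (-1) ^ j * ?s j"] by simp
    also have "\<dots> = xmon (hd L) * P (tl L) - (\<Sum>j<p. (-1) ^ j * P (merge_at j L)) -
       (-1) ^ p * P (butlast L) * act g (xmon (last L))"
      unfolding first last middle_sum by (simp add: sum_negf mult.assoc)
    finally show "(\<Sum>j\<le>p + 1. (-1) ^ j * ?s j) = \<dots>" .
  qed
  finally show ?thesis
    unfolding bar_codiff_def by (subst bar_hom_eq[of "bar_d (p + 1) ?t" \<phi> P, OF keys]) simp_all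
qed

text \<open>
  On \<open>S(V) g\<close> the element \<open>v\<^sub>i \<otimes> 1 - 1 \<otimes> v\<^sub>i\<close> of the enveloping algebra acts as multiplication by
  \<open>v\<^sub>i - \<^sup>gv\<^sub>i = (1 - \<epsilon>\<^sub>i) v\<^sub>i\<close>.
\<close>

lemma kos_codiff_lookup:
  assumes \<alpha>: "\<alpha> \<in> kcochains n g p"
  shows "Poly_Mapping.lookup (kos_codiff G act n p \<alpha>) J =
    (if J \<in> inc n (Suc p)
     then Poly_Mapping.single g (koszul_diff (\<lambda>i. cst (1 - \<epsilon> i) * xvar i) (coeff \<alpha>) J) else 0)"
proof -
  have "kos_hom G act \<alpha> (kos_d (p + 1) (Poly_Mapping.single J 1)) =
      Poly_Mapping.single g (koszul_diff (\<lambda>i. cst (1 - \<epsilon> i) * xvar i) (coeff \<alpha>) J)"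
    if J: "J \<in> inc n (Suc p)" for J
  proof -
    let ?e = "\<lambda>i. Poly_Mapping.single (J ! i) (1::nat)"
    let ?d = "\<lambda>i. Poly_Mapping.single (?e i, 0) 1 - Poly_Mapping.single (0, ?e i) 1 :: senv"
    have sign: "(-1) ^ i * x = Poly_Mapping.single 0 ((-1) ^ i) * x" for i and x :: senv
      by (induction i) (simp_all add: mult_single[of 0 _ 0, simplified, symmetric] mult.assoc single_uminus)
    have "lin_ext (sandwich f) ((-1) ^ i * ?d i) = (-1) ^ i * (cst (1 - \<epsilon> (J ! i)) * xvar (J ! i)) * f"
      if "i < Suc p" for i f
    proof -
      have i: "J ! i \<in> {1..n}"
        using J that nth_mem[of i J] by (auto simp: inc_def simp del: nth_mem)
      have "act g (xmon (?e i)) = cst (\<epsilon> (J ! i)) * xvar (J ! i)"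
        using i by (simp add: act_xmon mons_single weight_single xvar_def)
      moreover have "act g 1 = 1"
        by (simp add: act_g lin_ext_one twist_def weight_def)
      ultimately show ?thesis
        unfolding sign right_diff_distrib
        by (simp add: mult_single lin_ext_diff cst_minus_one_power sandwich_def xvar_def cst_diff algebra_simps)
    qed
    thus ?thesis
      using J unfolding kos_hom_eq[OF \<alpha>]
      by (simp add: kos_d_def kos_eval_sum kos_eval_single koszul_diff_def inc_def mult.assoc
          flip: Suc_eq_plus1 del: sum.lessThan_Suc)
  qed
  thus ?thesis
    unfolding kos_codiff_def
    by (simp add: lookup_sum lookup_single when_def finite_inc sum.delta' flip: Suc_eq_plus1)
qed

lemma kos_codiff_kcochains:
  assumes \<alpha>: "\<alpha> \<in> kcochains n g p"
  shows "kos_codiff G act n p \<alpha> \<in> kcochains n g (Suc p)"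
proof -
  have "koszul_diff (\<lambda>i. cst (1 - \<epsilon> i) * xvar i) (coeff \<alpha>) J \<in> SV n" if "J \<in> inc n (Suc p)" for J
  proof -
    have neg: "(-1) ^ i \<in> SV n" for i
      using SV_cst[of "(-1) ^ i"] by (simp add: cst_minus_one_power)
    have "J ! i \<in> {1..n}" if "i < length J" for i
      using that \<open>J \<in> inc n (Suc p)\<close> nth_mem[of i J] by (auto simp: inc_def simp del: nth_mem)
    thus ?thesis
      unfolding koszul_diff_def xvar_def
      by (intro SV_sum SV_mult neg SV_cst SV_xmon mons_single kcochain_coeff(2)[OF \<alpha>]) auto
  qed
  moreover have "0 \<in> Sbar n g"
    using SV_0[of n] single_zero[of g] unfolding Sbar_def by (metis image_eqI)
  ultimately show ?thesis
    by (auto simp: kcochains_def kos_codiff_lookup[OF \<alpha>] in_keys_iff Sbar_def split: if_splits)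
qed

text \<open>
  Both sides are linear extensions from lists of monomials, where \<open>ordered_sum_koszul_diff\<close> applies with
  the lower bound \<open>0\<close>: then \<open>T\<^bsub>lo+1\<^esub> = T\<^sub>1\<close> is the identity and \<open>T\<^sub>n\<^sub>+\<^sub>1\<close> is the action of \<open>g\<close>.
\<close>

lemma upsilon_codiff:
  assumes \<alpha>: "\<alpha> \<in> kcochains n g p" and fs: "fs \<in> SVlists n (Suc p)"
  shows "bar_codiff G act p (upsilon G act scale n v \<epsilon> p \<alpha>) fs =
    upsilon G act scale n v \<epsilon> (Suc p) (kos_codiff G act n p \<alpha>) fs"
proof -
  let ?D = "twisted_deriv n \<epsilon>" and ?T = "twist n \<epsilon>" and ?y = "\<lambda>i. cst (1 - \<epsilon> i) * xvar i"
  let ?P = "\<lambda>L. ordered_sum ?D n 0 L (coeff \<alpha>)"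
  have "upsilon G act scale n v \<epsilon> p \<alpha> (map xmon L) = Poly_Mapping.single g (?P L) \<and> ?P L \<in> SV n"
    if "length L = p" "set L \<subseteq> mons n" for L
    using that by (simp add: upsilon_eq[OF \<alpha>] SVlists_xmon lin_ext_ptens_xmon SV_ordered_sum[OF \<alpha>])
  from bar_codiff_eq[of p "upsilon G act scale n v \<epsilon> p \<alpha>" ?P, OF this fs]
  have "bar_codiff G act p (upsilon G act scale n v \<epsilon> p \<alpha>) fs = Poly_Mapping.single g
    (lin_ext (\<lambda>L. xmon (hd L) * ?P (tl L) - (\<Sum>j<p. (-1) ^ j * ?P (merge_at j L)) -
       (-1) ^ p * ?P (butlast L) * act g (xmon (last L))) (ptens fs))" .
  also have "lin_ext (\<lambda>L. xmon (hd L) * ?P (tl L) - (\<Sum>j<p. (-1) ^ j * ?P (merge_at j L)) -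
       (-1) ^ p * ?P (butlast L) * act g (xmon (last L))) (ptens fs) =
      lin_ext (\<lambda>L. ordered_sum ?D n 0 L (coeff (kos_codiff G act n p \<alpha>))) (ptens fs)"
  proof (rule lin_ext_cong)
    fix L assume "L \<in> Poly_Mapping.keys (ptens fs)"
    note L = keys_ptens_SV[OF fs this]
    then obtain a K where aK: "L = a # K"
      by (cases L) auto
    have "last L \<in> mons n"
      using L aK by (metis last_in_set list.distinct(1) subsetD)
    hence "act g (xmon (last L)) = ?T (Suc n) (last L)"
      by (simp add: act_xmon twist_def)
    moreover have "xmon (hd L) = ?T 1 a"
      using aK by (simp add: twist_def One_nat_def)
    moreover have "ordered_sum ?D n 0 L (coeff (kos_codiff G act n p \<alpha>)) =
        ordered_sum ?D n 0 L (koszul_diff ?y (coeff \<alpha>))"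
      unfolding ordered_sum_eq_sum L(1)
      by (intro sum.cong refl arg_cong2[where f = "(*)"]) (simp add: coeff_def kos_codiff_lookup[OF \<alpha>])
    ultimately show "xmon (hd L) * ?P (tl L) - (\<Sum>j<p. (-1) ^ j * ?P (merge_at j L)) -
       (-1) ^ p * ?P (butlast L) * act g (xmon (last L)) =
       ordered_sum ?D n 0 L (coeff (kos_codiff G act n p \<alpha>))"
      using L ordered_sum_koszul_diff[of n ?D ?T ?y 0 a K "coeff \<alpha>", OF twisted_deriv_add xvar_mult_twisted_deriv]
      by (simp add: aK merge_sum_def One_nat_def ac_simps)
  qed
  finally show ?thesis
    by (simp add: upsilon_eq[OF kos_codiff_kcochains[OF \<alpha>] fs])
qed

lemma upsilon_bcochains:
  assumes \<alpha>: "\<alpha> \<in> kcochains n g p"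
  shows "upsilon G act scale n v \<epsilon> p \<alpha> \<in> bcochains n g p"
proof -
  define U where "U fs = (\<Sum>J\<in>inc n p. (\<Prod>k<p. lin_ext (twisted_deriv n \<epsilon> (J ! k)) (fs ! k)) * coeff \<alpha> J)" for fs
  \<comment> \<open>Only the factor at position \<open>k\<close> depends on \<open>f\<close>, and it is linear in \<open>f\<close>.\<close>
  have split: "U (fs[k := f]) =
      (\<Sum>J\<in>inc n p. lin_ext (twisted_deriv n \<epsilon> (J ! k)) f *
        ((\<Prod>i\<in>{..<p} - {k}. lin_ext (twisted_deriv n \<epsilon> (J ! i)) (fs ! i)) * coeff \<alpha> J))"
    if "k < p" "length fs = p" for fs k f
    unfolding U_def
  proof (intro sum.cong refl)
    fix J
    have "(\<Prod>i\<in>{..<p} - {k}. lin_ext (twisted_deriv n \<epsilon> (J ! i)) (fs[k := f] ! i)) =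
        (\<Prod>i\<in>{..<p} - {k}. lin_ext (twisted_deriv n \<epsilon> (J ! i)) (fs ! i))"
      by (intro prod.cong) auto
    thus "(\<Prod>i<p. lin_ext (twisted_deriv n \<epsilon> (J ! i)) (fs[k := f] ! i)) * coeff \<alpha> J =
        lin_ext (twisted_deriv n \<epsilon> (J ! k)) f *
        ((\<Prod>i\<in>{..<p} - {k}. lin_ext (twisted_deriv n \<epsilon> (J ! i)) (fs ! i)) * coeff \<alpha> J)"
      using that by (simp add: prod.remove[of "{..<p}" k] mult.assoc)
  qed
  have ups: "upsilon G act scale n v \<epsilon> p \<alpha> fs = Poly_Mapping.single g (U fs)"
    if "fs \<in> SVlists n p" for fs
    using upsilon_eq_sum[OF \<alpha> that] by (simp add: U_def)
  have upd: "fs[k := f] \<in> SVlists n p" if "fs \<in> SVlists n p" "f \<in> SV n" for fs k f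
    using that set_update_subset_insert[of fs k f] by (auto simp: SVlists_def)
  show ?thesis
    unfolding bcochains_def
  proof (intro CollectI ballI conjI allI impI)
    fix fs assume fs: "fs \<in> SVlists n p"
    hence len: "length fs = p" by (simp add: SVlists_def)
    show "upsilon G act scale n v \<epsilon> p \<alpha> fs \<in> Sbar n g"
      using SV_upsilon_sum[OF \<alpha> fs] by (simp add: ups[OF fs] U_def Sbar_def)
    fix k f h c assume k: "k < p" and f: "f \<in> SV n" and h: "h \<in> SV n"
    show "upsilon G act scale n v \<epsilon> p \<alpha> (fs[k := f + h]) =
        upsilon G act scale n v \<epsilon> p \<alpha> (fs[k := f]) + upsilon G act scale n v \<epsilon> p \<alpha> (fs[k := h])"
      using f h by (simp add: ups upd[OF fs] SV_add split[OF k len] lin_ext_add distrib_right sum.distrib single_add)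
    show "upsilon G act scale n v \<epsilon> p \<alpha> (fs[k := cst c * f]) =
        cscale c (upsilon G act scale n v \<epsilon> p \<alpha> (fs[k := f]))"
      using f by (simp add: ups upd[OF fs] SV_mult split[OF k len] lin_ext_cst_mult sum_distrib_left mult.assoc)
  qed
qed

lemma upsilon_add:
  assumes "\<alpha> \<in> kcochains n g p" "\<beta> \<in> kcochains n g p" "fs \<in> SVlists n p"
  shows "upsilon G act scale n v \<epsilon> p (\<alpha> + \<beta>) fs =
    upsilon G act scale n v \<epsilon> p \<alpha> fs + upsilon G act scale n v \<epsilon> p \<beta> fs"
proof -
  have "\<alpha> + \<beta> \<in> kcochains n g p"
    using assms(1,2) keys_add[of \<alpha> \<beta>]
    by (auto simp: kcochains_def lookup_add Sbar_def image_iff single_add[symmetric] intro!: exI)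
      (metis SV_add single_add)
  thus ?thesis
    using assms by (simp add: upsilon_eq_sum coeff_def lookup_add distrib_left sum.distrib single_add)
qed

lemma upsilon_scale:
  assumes \<alpha>: "\<alpha> \<in> kcochains n g p" and fs: "fs \<in> SVlists n p"
  shows "upsilon G act scale n v \<epsilon> p (Poly_Mapping.map (cscale c) \<alpha>) fs =
    cscale c (upsilon G act scale n v \<epsilon> p \<alpha> fs)"
proof -
  have lookup: "Poly_Mapping.lookup (Poly_Mapping.map (cscale c) \<alpha>) J = Poly_Mapping.single g (cst c * coeff \<alpha> J)" for J
  proof -
    have "Poly_Mapping.lookup (Poly_Mapping.map (cscale c) \<alpha>) J = cscale c (Poly_Mapping.lookup \<alpha> J)"
      by (simp add: map.rep_eq when_def cscale_def poly_mapping_eq_iff fun_eq_iff)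
    thus ?thesis by (simp add: kcochain_coeff(1)[OF \<alpha>])
  qed
  have "Poly_Mapping.keys (Poly_Mapping.map (cscale c) \<alpha>) \<subseteq> Poly_Mapping.keys \<alpha>"
    by (auto simp: in_keys_iff map.rep_eq when_def)
  hence "Poly_Mapping.map (cscale c) \<alpha> \<in> kcochains n g p"
    using \<alpha> kcochain_coeff(2)[OF \<alpha>]
    by (auto simp: kcochains_def lookup Sbar_def intro!: SV_mult)
  moreover have "coeff (Poly_Mapping.map (cscale c) \<alpha>) J = cst c * coeff \<alpha> J" for J
    by (simp add: coeff_def[of "Poly_Mapping.map (cscale c) \<alpha>"] lookup)
  ultimately show ?thesis
    using assms by (simp add: upsilon_eq_sum sum_distrib_left ac_simps)
qed

end

section \<open>The comparison theorem\<close>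

theorem theorem5p1:
  fixes G :: "('g, 'm) monoid_scheme"
    and scale :: "complex \<Rightarrow> 'v::ab_group_add \<Rightarrow> 'v"
    and \<rho> :: "'g \<Rightarrow> 'v \<Rightarrow> 'v"
    and g :: 'g
    and n :: nat
    and v :: "nat \<Rightarrow> 'v"
    and \<epsilon> :: "nat \<Rightarrow> complex"
  assumes "Group.group G" and "finite (carrier G)"
    and "cg_module G scale \<rho>"
    and "g \<in> carrier G"
    and "is_basis scale n v"
    and "\<forall>i\<in>{1..n}. \<rho> g (v i) = scale (\<epsilon> i) (v i)"
  shows "(\<forall>p. \<forall>\<alpha>\<in>kcochains n g p. \<forall>fs\<in>SVlists n p.
            upsilon G (gact scale n v \<rho>) scale n v \<epsilon> p \<alpha> fs
              = psi_star G (gact scale n v \<rho>) n p \<alpha> fs) \<and>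
         is_cochain_map G (gact scale n v \<rho>) n g (upsilon G (gact scale n v \<rho>) scale n v \<epsilon>)"
proof -
  interpret eigenbasis G scale \<rho> g n v \<epsilon>
    using assms by (intro eigenbasis.intro)
  show ?thesis
    unfolding is_cochain_map_def
    by (auto simp: upsilon_eq psi_star_eq upsilon_bcochains upsilon_add upsilon_scale
        kos_codiff_kcochains upsilon_codiff simp flip: Suc_eq_plus1)
qed

end
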